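(* Let $T\neq0$ be a bounded, linear, self-adjoint operator on $L^2(G,\mathbb{C}^{s\times r})$ that is adjointable with respect to the matrix-valued inner product, and let $\{E_k\}_{k\in\mathbb{N}}$ be a matrix-valued orthonormal basis for $L^2(G,\mathbb{C}^{s\times r})$. Then $$\Big\{\tfrac{1}{\|T\|}\big[T+i\big(\|T\|^2I-T^2\big)^{1/2}\big]E_k\Big\}_{k\in\mathbb{N}}\quad\text{and}\quad\Big\{\tfrac{1}{\|T\|}\big[T-i\big(\|T\|^2I-T^2\big)^{1/2}\big]E_k\Big\}_{k\in\mathbb{N}}$$ are matrix-valued Riesz bases for $L^2(G,\mathbb{C}^{s\times r})$, where $I$ is the identity operator.
   Context: $G$ is a locally compact abelian group that is metrizable and $\sigma$-compact, with Haar measure $\mu_G$; $s,r\in\mathbb{N}$. $L^2(G,\mathbb{C}^{s\times r})$ is the space of $s\times r$ matrices with all entries in $L^2(G)$. The matrix-valued inner product is $\langle \mathbf{f},\mathbf{g}\rangle=\int_G \mathbf{f}(x)\mathbf{g}^*(x)\,d\mu_G\in M_s(\mathbb{C})$ (entrywise integral). $L^2(G,\mathbb{C}^{s\times r})$ is a Hilbert space with inner product $\langle \mathbf{f},\mathbf{g}\rangle_{L^2}=\mathrm{tr}\langle \mathbf{f},\mathbf{g}\rangle$ and Frobenius norm; $\|T\|$ is the operator norm, $U^*$ the Hilbert-adjoint with respect to this inner product, and self-adjoint means $T^*=T$. $U$ is adjointable with respect to the matrix-valued inner product if $\langle U\mathbf{f},\mathbf{g}\rangle=\langle\mathbf{f},U^*\mathbf{g}\rangle$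 for all $\mathbf{f},\mathbf{g}$. For a positive operator $P$ ($P^*=P$, $\mathrm{tr}\langle P\mathbf{f},\mathbf{f}\rangle\ge0$ for all $\mathbf{f}$), $P^{1/2}$ is the unique bounded positive operator whose square is $P$. A matrix-valued orthonormal basis is a sequence $\{E_k\}_{k\in\mathbb{N}}$ with $\langle E_k,E_j\rangle=\mathbf{I}_{s\times s}$ if $k=j$ and $\mathbf{O}_{s\times s}$ otherwise, such that $\mathbf{f}=\sum_k\langle\mathbf{f},E_k\rangle E_k$ in Frobenius norm for all $\mathbf{f}$. A matrix-valued Riesz basis is a family $\{VE_k\}_{k\in\mathbb{N}}$ with $\{E_k\}$ a matrix-valued orthonormal basis and $V$ bounded, linear, bijective and adjointable with respect to the matrix-valued inner product. *)

theory Defs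
  imports "HOL-Analysis.Analysis"
begin

text \<open>Standing assumptions on G: a locally compact abelian group which is metrizable
  (the type carries a metric inducing its topology) and sigma-compact, together with
  a Haar measure M (nonzero, translation invariant, finite on compacts, regular Borel).\<close>

definition lca_haar :: "'g::{metric_space,ab_group_add} measure \<Rightarrow> bool" where
  "lca_haar M \<longleftrightarrow>
     continuous_on UNIV (\<lambda>p::'g \<times> 'g. fst p + snd p) \<and>
     continuous_on UNIV (uminus :: 'g \<Rightarrow> 'g) \<and>
     (\<forall>x::'g. \<exists>U K. open U \<and> compact K \<and> x \<in> U \<and> U \<subseteq> K) \<and>
     (\<exists>K::nat \<Rightarrow> 'g set. (\<forall>n. compact (K n)) \<and> (\<Union>n. K n) = UNIV) \<and>
     sets M = sets (borel :: 'g measure) \<and>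
     emeasure M UNIV \<noteq> 0 \<and>
     (\<forall>a A. A \<in> sets (borel :: 'g measure) \<longrightarrow> emeasure M ((\<lambda>x. a + x) ` A) = emeasure M A) \<and>
     (\<forall>K. compact K \<longrightarrow> emeasure M K < \<infinity>) \<and>
     (\<forall>A \<in> sets (borel :: 'g measure).
         emeasure M A = (INF U \<in> {U. open U \<and> A \<subseteq> U}. emeasure M U)) \<and>
     (\<forall>U. open U \<longrightarrow> emeasure M U = (SUP K \<in> {K. compact K \<and> K \<subseteq> U}. emeasure M K))"

text \<open>L^2(G, C^{s x r}): functions G -> s x r complex matrices (complex^'r^'s, rows indexed
  by 's) with all entries in L^2. Elements are identified up to null functions (eqL2).\<close>

definition L2m :: "'g measure \<Rightarrow> ('g \<Rightarrow> complex^'r^'s) set" where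
  "L2m M = {f. \<forall>i j. (\<lambda>x. f x $ i $ j) \<in> borel_measurable M \<and>
                      integrable M (\<lambda>x. (cmod (f x $ i $ j))\<^sup>2)}"

definition mip :: "'g measure \<Rightarrow> ('g \<Rightarrow> complex^'r^'s) \<Rightarrow> ('g \<Rightarrow> complex^'r^'s) \<Rightarrow> complex^'s^'s" where
  "mip M f g = (\<chi> i j. LINT x|M. (\<Sum>k\<in>UNIV. f x $ i $ k * cnj (g x $ j $ k)))"

definition mtrace :: "complex^'s^'s \<Rightarrow> complex" where
  "mtrace A = (\<Sum>i\<in>UNIV. A $ i $ i)"

definition l2inner :: "'g measure \<Rightarrow> ('g \<Rightarrow> complex^'r^'s) \<Rightarrow> ('g \<Rightarrow> complex^'r^'s) \<Rightarrow> complex" where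
  "l2inner M f g = mtrace (mip M f g)"

definition l2norm :: "'g measure \<Rightarrow> ('g \<Rightarrow> complex^'r^'s) \<Rightarrow> real" where
  "l2norm M f = sqrt (Re (l2inner M f f))"

definition eqL2 :: "'g measure \<Rightarrow> ('g \<Rightarrow> complex^'r^'s) \<Rightarrow> ('g \<Rightarrow> complex^'r^'s) \<Rightarrow> bool" where
  "eqL2 M f g \<longleftrightarrow> l2norm M (\<lambda>x. f x - g x) = 0"

definition mscale :: "complex \<Rightarrow> complex^'r^'s \<Rightarrow> complex^'r^'s" where
  "mscale c A = (\<chi> i j. c * A $ i $ j)"


text \<open>Bounded (complex-)linear operators on L^2 (represented on representatives, well defined
  on classes).\<close>
definition bounded_linear_op :: "'g measure \<Rightarrow> (('g \<Rightarrow> complex^'r::finite^'s::finite) \<Rightarrow> ('g \<Rightarrow> complex^'r^'s)) \<Rightarrow> bool" where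
  "bounded_linear_op M T \<longleftrightarrow>
     (\<forall>f \<in> L2m M. T f \<in> L2m M) \<and>
     (\<forall>f \<in> L2m M. \<forall>g \<in> L2m M. eqL2 M f g \<longrightarrow> eqL2 M (T f) (T g)) \<and>
     (\<forall>f \<in> L2m M. \<forall>g \<in> L2m M. \<forall>a b.
        eqL2 M (T (\<lambda>x. mscale a (f x) + mscale b (g x)))
               (\<lambda>x. mscale a (T f x) + mscale b (T g x))) \<and>
     (\<exists>C. \<forall>f \<in> L2m M. l2norm M (T f) \<le> C * l2norm M f)"

definition opnorm :: "'g measure \<Rightarrow> (('g \<Rightarrow> complex^'r::finite^'s::finite) \<Rightarrow> ('g \<Rightarrow> complex^'r^'s)) \<Rightarrow> real" where
  "opnorm M T = Sup {l2norm M (T f) | f. f \<in> L2m M \<and> l2norm M f \<le> 1}"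

definition selfadj_op :: "'g measure \<Rightarrow> (('g \<Rightarrow> complex^'r::finite^'s::finite) \<Rightarrow> ('g \<Rightarrow> complex^'r^'s)) \<Rightarrow> bool" where
  "selfadj_op M T \<longleftrightarrow> (\<forall>f \<in> L2m M. \<forall>g \<in> L2m M. l2inner M (T f) g = l2inner M f (T g))"

definition mv_adjointable :: "'g measure \<Rightarrow> (('g \<Rightarrow> complex^'r::finite^'s::finite) \<Rightarrow> ('g \<Rightarrow> complex^'r^'s)) \<Rightarrow> bool" where
  "mv_adjointable M T \<longleftrightarrow>
     (\<exists>S. bounded_linear_op M S \<and>
          (\<forall>f \<in> L2m M. \<forall>g \<in> L2m M. l2inner M (T f) g = l2inner M f (S g)) \<and>
          (\<forall>f \<in> L2m M. \<forall>g \<in> L2m M. mip M (T f) g = mip M f (S g)))"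

definition positive_op :: "'g measure \<Rightarrow> (('g \<Rightarrow> complex^'r::finite^'s::finite) \<Rightarrow> ('g \<Rightarrow> complex^'r^'s)) \<Rightarrow> bool" where
  "positive_op M P \<longleftrightarrow> selfadj_op M P \<and>
     (\<forall>f \<in> L2m M. Im (l2inner M (P f) f) = 0 \<and> Re (l2inner M (P f) f) \<ge> 0)"

text \<open>P^{1/2}: the (unique up to L^2-equality) bounded positive operator whose square is P.\<close>
definition op_sqrt :: "'g measure \<Rightarrow> (('g \<Rightarrow> complex^'r::finite^'s::finite) \<Rightarrow> ('g \<Rightarrow> complex^'r^'s)) \<Rightarrow> (('g \<Rightarrow> complex^'r::finite^'s::finite) \<Rightarrow> ('g \<Rightarrow> complex^'r^'s))" where
  "op_sqrt M P = (SOME Q. bounded_linear_op M Q \<and> positive_op M Q \<and>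
                          (\<forall>f \<in> L2m M. eqL2 M (Q (Q f)) (P f)))"

definition mv_onb :: "'g measure \<Rightarrow> (nat \<Rightarrow> ('g \<Rightarrow> complex^'r^'s)) \<Rightarrow> bool" where
  "mv_onb M E \<longleftrightarrow>
     (\<forall>k. E k \<in> L2m M) \<and>
     (\<forall>k j. mip M (E k) (E j) = (if k = j then mat 1 else 0)) \<and>
     (\<forall>f \<in> L2m M. (\<lambda>n. l2norm M (\<lambda>x. f x - (\<Sum>k<n. mip M f (E k) ** E k x)))
                    \<longlonglongrightarrow> 0)"

definition bijective_op :: "'g measure \<Rightarrow> (('g \<Rightarrow> complex^'r::finite^'s::finite) \<Rightarrow> ('g \<Rightarrow> complex^'r^'s)) \<Rightarrow> bool" where
  "bijective_op M V \<longleftrightarrow>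
     (\<forall>f \<in> L2m M. \<forall>g \<in> L2m M. eqL2 M (V f) (V g) \<longrightarrow> eqL2 M f g) \<and>
     (\<forall>g \<in> L2m M. \<exists>f \<in> L2m M. eqL2 M (V f) g)"

definition mv_riesz :: "'g measure \<Rightarrow> (nat \<Rightarrow> ('g \<Rightarrow> complex^'r^'s)) \<Rightarrow> bool" where
  "mv_riesz M F \<longleftrightarrow>
     (\<exists>E V. mv_onb M E \<and> bounded_linear_op M V \<and> bijective_op M V \<and> mv_adjointable M V \<and>
            (\<forall>k. F k \<in> L2m M \<and> eqL2 M (F k) (V (E k))))"

end

theory Submission
  imports Defs
begin

text \<open>Put \<open>c = \<parallel>T\<parallel>\<close> and \<open>Q = (c\<^sup>2 - T\<^sup>2)\<^sup>1\<^sup>/\<^sup>2\<close>. The operators \<open>V = (T + \<i> Q) / c\<close> and \<open>W = (T - \<i> Q) / c\<close>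
  satisfy \<open>V W = W V = (T\<^sup>2 + Q\<^sup>2) / c\<^sup>2 = 1\<close> because \<open>Q\<close> commutes with \<open>T\<close>, and \<open>W\<close> is the adjoint of \<open>V\<close>
  for the matrix-valued inner product as soon as \<open>Q\<close> is adjointable, so both map the given
  orthonormal basis to a Riesz basis. A self-adjoint operator is adjointable for
  the matrix-valued inner product if and only if it commutes with left multiplication by constant matrices.
  Everything thus follows from the fact that \<open>Q\<close> commutes with every bounded operator commuting with \<open>T\<close>.
  For a contraction \<open>B\<close> the iteration \<open>Y\<^sub>0 = 0\<close>, \<open>Y\<^sub>n\<^sub>+\<^sub>1 = (B + Y\<^sub>n\<^sup>2) / 2\<close> converges in norm, being dominated by
  the same iteration for the scalar 1, and its limit \<open>Y\<close> satisfies \<open>(1 - Y)\<^sup>2 = 1 - B\<close>.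
  With \<open>B = T\<^sup>2 / c\<^sup>2\<close> this gives a positive square root \<open>c (1 - Y)\<close> with that commutation
  property, and every other positive square root coincides with it.\<close>

section \<open>Positive square roots in complete semi-inner product spaces\<close>

text \<open>\<open>lc a f b g\<close> stands for \<open>a f + b g\<close>. Vectors are representatives modulo the null space of \<open>nrm\<close>;
  all identities are stated weakly, through inner products with arbitrary vectors, so no quotient is formed.\<close>

locale semi_hilbert =
  fixes H :: "'v set"
    and lc :: "complex \<Rightarrow> 'v \<Rightarrow> complex \<Rightarrow> 'v \<Rightarrow> 'v"
    and ip :: "'v \<Rightarrow> 'v \<Rightarrow> complex"
    and nrm :: "'v \<Rightarrow> real"
  assumes lc_closed [simp, intro]: "f \<in> H \<Longrightarrow> g \<in> H \<Longrightarrow> lc a f b g \<in> H"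
    and ip_lc_left [simp]:
      "f \<in> H \<Longrightarrow> g \<in> H \<Longrightarrow> h \<in> H \<Longrightarrow> ip (lc a f b g) h = a * ip f h + b * ip g h"
    and ip_cnj: "f \<in> H \<Longrightarrow> g \<in> H \<Longrightarrow> ip f g = cnj (ip g f)"
    and ip_nonneg: "f \<in> H \<Longrightarrow> 0 \<le> Re (ip f f)"
    and nrm_eq: "nrm f = sqrt (Re (ip f f))"
    and complete: "(\<And>n. s n \<in> H) \<Longrightarrow> summable (\<lambda>n. nrm (lc 1 (s (Suc n)) (-1) (s n)))
      \<Longrightarrow> \<exists>g\<in>H. (\<lambda>n::nat. nrm (lc 1 (s n) (-1) g)) \<longlonglongrightarrow> 0"
begin

section \<open>Semi-inner product geometry: norm expansion, Cauchy-Schwarz and equality modulo null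
  vectors\<close>

lemma ip_lc_right [simp]:
  assumes "f \<in> H" "g \<in> H" "h \<in> H"
  shows "ip h (lc a f b g) = cnj a * ip h f + cnj b * ip h g"
  using assms ip_cnj[of h "lc a f b g"] ip_cnj[of h f] ip_cnj[of h g] by simp

lemma ip_self: "f \<in> H \<Longrightarrow> ip f f = complex_of_real ((nrm f)\<^sup>2)"
  using ip_cnj[of f f] ip_nonneg[of f] by (simp add: nrm_eq complex_eq_iff)

lemma nrm_ge_0 [simp]: "f \<in> H \<Longrightarrow> 0 \<le> nrm f"
  by (simp add: nrm_eq ip_nonneg)

lemma nrm_lc_sq:
  assumes "f \<in> H" "g \<in> H"
  shows "(nrm (lc a f b g))\<^sup>2 = (cmod a)\<^sup>2 * (nrm f)\<^sup>2 + (cmod b)\<^sup>2 * (nrm g)\<^sup>2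
           + 2 * Re (a * cnj b * ip f g)"
proof -
  have "complex_of_real ((nrm (lc a f b g))\<^sup>2) = ip (lc a f b g) (lc a f b g)"
    using assms by (intro ip_self[symmetric]) simp
  also have "\<dots> = a * cnj a * ip f f + b * cnj b * ip g g + (a * cnj b * ip f g + cnj (a * cnj b * ip f g))"
    using assms ip_cnj[of g f] by (simp add: algebra_simps)
  also have "\<dots> = complex_of_real ((cmod a)\<^sup>2 * (nrm f)\<^sup>2 + (cmod b)\<^sup>2 * (nrm g)\<^sup>2
           + 2 * Re (a * cnj b * ip f g))"
    using assms by (simp add: ip_self complex_add_cnj complex_norm_square[symmetric] del: complex_cnj_mult)
  finally show ?thesis using of_real_eq_iff by blast
qed

text \<open>The form is only semidefinite, so a null \<open>g\<close> is treated separately: there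
  the squared norm of \<open>f\<close> minus a multiple \<open>s\<close> of \<open>ip f g\<close>
  times \<open>g\<close> is affine in \<open>s\<close>, hence unbounded below unless
  \<open>ip f g = 0\<close>.\<close>

lemma cauchy_schwarz:
  assumes "f \<in> H" "g \<in> H"
  shows "cmod (ip f g) \<le> nrm f * nrm g"
proof (cases "nrm g = 0")
  case True
  have "cmod (ip f g) = 0"
  proof (rule ccontr)
    assume p: "cmod (ip f g) \<noteq> 0"
    \<comment> \<open>Chosen so that the affine expression
      \<open>(nrm f)\<^sup>2 - 2 * s * (cmod (ip f g))\<^sup>2\<close> takes the value -1.\<close>
    define s where "s = ((nrm f)\<^sup>2 + 1) / (2 * (cmod (ip f g))\<^sup>2)"
    have re: "Re (1 * cnj (- of_real s * ip f g) * ip f g) = - s * (cmod (ip f g))\<^sup>2"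
      by (simp add: cmod_power2) (simp add: power2_eq_square algebra_simps)
    have "(nrm (lc 1 f (- of_real s * ip f g) g))\<^sup>2 = (nrm f)\<^sup>2 - 2 * s * (cmod (ip f g))\<^sup>2"
      unfolding nrm_lc_sq[OF assms] re using True by simp
    also have "\<dots> = -1"
      using p by (simp add: s_def field_simps)
    finally show False
      using zero_le_power2[of "nrm (lc 1 f (- of_real s * ip f g) g)"] by linarith
  qed
  then show ?thesis using assms by simp
next
  case False
  define G where "G = (nrm g)\<^sup>2"
  have G: "G > 0" using False by (simp add: G_def)
  have re: "Re (of_real G * cnj (- ip f g) * ip f g) = - G * (cmod (ip f g))\<^sup>2"
    by (simp add: cmod_power2) (simp add: power2_eq_square algebra_simps)
  \<comment> \<open>This is the residual of projecting \<open>f\<close> onto \<open>g\<close>,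
    scaled by \<open>G\<close> to avoid a division.\<close>
  have "(nrm (lc (of_real G) f (- ip f g) g))\<^sup>2 = G\<^sup>2 * (nrm f)\<^sup>2 + (cmod (ip f g))\<^sup>2 * G - 2 * G * (cmod (ip f g))\<^sup>2"
    unfolding nrm_lc_sq[OF assms] re G_def[symmetric] by simp
  also have "\<dots> = G * (G * (nrm f)\<^sup>2 - (cmod (ip f g))\<^sup>2)"
    by (simp add: power2_eq_square algebra_simps)
  finally have "(nrm (lc (of_real G) f (- ip f g) g))\<^sup>2 = G * (G * (nrm f)\<^sup>2 - (cmod (ip f g))\<^sup>2)" .
  then have "0 \<le> G * (G * (nrm f)\<^sup>2 - (cmod (ip f g))\<^sup>2)"
    by (metis zero_le_power2)
  then have "(cmod (ip f g))\<^sup>2 \<le> (nrm f * nrm g)\<^sup>2"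
    using G by (simp add: zero_le_mult_iff G_def power_mult_distrib mult.commute)
  then show ?thesis using assms by (simp add: power2_le_iff_abs_le)
qed

lemma nrm_lc_le:
  assumes "f \<in> H" "g \<in> H"
  shows "nrm (lc a f b g) \<le> cmod a * nrm f + cmod b * nrm g"
proof -
  have "Re (a * cnj b * ip f g) \<le> cmod (a * cnj b * ip f g)"
    by (rule complex_Re_le_cmod)
  also have "\<dots> \<le> cmod a * cmod b * (nrm f * nrm g)"
    using cauchy_schwarz[OF assms] by (simp add: norm_mult mult_left_mono)
  finally have "(nrm (lc a f b g))\<^sup>2 \<le> (cmod a * nrm f + cmod b * nrm g)\<^sup>2"
    unfolding nrm_lc_sq[OF assms] by (simp add: power2_eq_square algebra_simps)
  then show ?thesis
    by (rule power2_le_imp_le) (simp add: assms)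
qed

definition eqv :: "'v \<Rightarrow> 'v \<Rightarrow> bool" where
  "eqv f g \<longleftrightarrow> (\<forall>h\<in>H. ip f h = ip g h)"

lemma eqvI: "(\<And>h. h \<in> H \<Longrightarrow> ip f h = ip g h) \<Longrightarrow> eqv f g"
  by (simp add: eqv_def)

lemma eqvD: "eqv f g \<Longrightarrow> h \<in> H \<Longrightarrow> ip f h = ip g h"
  by (simp add: eqv_def)

lemma eqv_sym: "eqv f g \<Longrightarrow> eqv g f"
  by (simp add: eqv_def)

lemma eqv_trans [trans]: "eqv f g \<Longrightarrow> eqv g h \<Longrightarrow> eqv f h"
  by (simp add: eqv_def)

lemma eqvD_right: "eqv f g \<Longrightarrow> f \<in> H \<Longrightarrow> g \<in> H \<Longrightarrow> h \<in> H \<Longrightarrow> ip h f = ip h g"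
  using eqvD[of f g h] ip_cnj[of h f] ip_cnj[of h g] by simp

lemma eqv_nrm: "eqv f g \<Longrightarrow> f \<in> H \<Longrightarrow> g \<in> H \<Longrightarrow> nrm f = nrm g"
  using eqvD[of f g f] eqvD_right[of f g g] by (simp add: nrm_eq)

lemma nrm_0_ip: "f \<in> H \<Longrightarrow> h \<in> H \<Longrightarrow> nrm f = 0 \<Longrightarrow> ip f h = 0"
  using cauchy_schwarz[of f h] by simp

lemma eqv_iff_nrm:
  assumes "f \<in> H" "g \<in> H"
  shows "eqv f g \<longleftrightarrow> nrm (lc 1 f (-1) g) = 0"
proof
  assume "eqv f g"
  then show "nrm (lc 1 f (-1) g) = 0"
    using assms by (simp add: nrm_eq eqvD)
next
  assume *: "nrm (lc 1 f (-1) g) = 0"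
  show "eqv f g"
  proof (rule eqvI)
    fix h assume "h \<in> H"
    then show "ip f h = ip g h"
      using nrm_0_ip[of "lc 1 f (-1) g" h] * assms by simp
  qed
qed

lemma tendsto_ip:
  assumes "\<And>n. s n \<in> H" "g \<in> H" "h \<in> H" "(\<lambda>n::nat. nrm (lc 1 (s n) (-1) g)) \<longlonglongrightarrow> 0"
  shows "(\<lambda>n. ip (s n) h) \<longlonglongrightarrow> ip g h"
proof -
  have "(\<lambda>n. ip (s n) h - ip g h) \<longlonglongrightarrow> 0"
  proof (rule tendsto_0_le[where K = "nrm h", OF assms(4)], intro always_eventually allI)
    fix n
    show "norm (ip (s n) h - ip g h) \<le> norm (nrm (lc 1 (s n) (-1) g)) * nrm h"
      using cauchy_schwarz[of "lc 1 (s n) (-1) g" h] assms by simp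
  qed
  then show ?thesis by (simp add: LIM_zero_iff)
qed

section \<open>Bounded and symmetric operators modulo null vectors\<close>

definition bop :: "('v \<Rightarrow> 'v) \<Rightarrow> bool" where
  "bop T \<longleftrightarrow> (\<forall>f\<in>H. T f \<in> H) \<and>
     (\<forall>f\<in>H. \<forall>g\<in>H. \<forall>a b. eqv (T (lc a f b g)) (lc a (T f) b (T g))) \<and>
     (\<exists>C. \<forall>f\<in>H. nrm (T f) \<le> C * nrm f)"

definition symop :: "('v \<Rightarrow> 'v) \<Rightarrow> bool" where
  "symop T \<longleftrightarrow> (\<forall>f\<in>H. \<forall>g\<in>H. ip (T f) g = ip f (T g))"

lemma bop_in [simp, intro]: "bop T \<Longrightarrow> f \<in> H \<Longrightarrow> T f \<in> H"
  by (simp add: bop_def)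

lemma bop_lin:
  "bop T \<Longrightarrow> f \<in> H \<Longrightarrow> g \<in> H \<Longrightarrow> h \<in> H \<Longrightarrow>
    ip (T (lc a f b g)) h = a * ip (T f) h + b * ip (T g) h"
  using eqvD[of "T (lc a f b g)" "lc a (T f) b (T g)" h] by (simp add: bop_def)

lemma bop_bound:
  assumes "bop T"
  obtains C where "C \<ge> 0" "\<And>f. f \<in> H \<Longrightarrow> nrm (T f) \<le> C * nrm f"
proof -
  obtain C where C: "\<And>f. f \<in> H \<Longrightarrow> nrm (T f) \<le> C * nrm f"
    using assms unfolding bop_def by blast
  show ?thesis
  proof (rule that[of "max C 0"])
    fix f assume f: "f \<in> H"
    have "nrm (T f) \<le> C * nrm f" by (rule C[OF f])
    also have "\<dots> \<le> max C 0 * nrm f" using f by (simp add: mult_right_mono)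
    finally show "nrm (T f) \<le> max C 0 * nrm f" .
  qed simp
qed

lemma bopI:
  assumes "\<And>f. f \<in> H \<Longrightarrow> T f \<in> H"
    and "\<And>f g h a b. f \<in> H \<Longrightarrow> g \<in> H \<Longrightarrow> h \<in> H \<Longrightarrow>
          ip (T (lc a f b g)) h = a * ip (T f) h + b * ip (T g) h"
    and "\<And>f. f \<in> H \<Longrightarrow> nrm (T f) \<le> C * nrm f"
  shows "bop T"
  unfolding bop_def using assms by (intro conjI ballI allI exI[of _ C]) (auto intro!: eqvI)

lemma bop_nrm_diff:
  assumes "bop T" "f \<in> H" "g \<in> H"
  shows "nrm (lc 1 (T f) (-1) (T g)) = nrm (T (lc 1 f (-1) g))"
  by (rule eqv_nrm) (use assms in \<open>auto intro!: eqvI simp: bop_lin\<close>)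

text \<open>The bound sends null vectors to null vectors, so an operator linear up to
  \<open>eqv\<close> respects \<open>eqv\<close>. This is what makes weak identities usable under an
  operator.\<close>

lemma bop_cong:
  assumes T: "bop T" and "f \<in> H" "g \<in> H" "eqv f g"
  shows "eqv (T f) (T g)"
proof -
  obtain C where C: "C \<ge> 0" "\<And>f. f \<in> H \<Longrightarrow> nrm (T f) \<le> C * nrm f"
    using T by (rule bop_bound) blast
  have "nrm (T (lc 1 f (-1) g)) \<le> C * 0"
    using C(2)[of "lc 1 f (-1) g"] assms eqv_iff_nrm[of f g] by simp
  then have "nrm (T (lc 1 f (-1) g)) = 0"
    using assms by (intro antisym) auto
  then show ?thesis
    using assms bop_nrm_diff[of T f g] by (simp add: eqv_iff_nrm)
qed

lemma bop_id: "bop (\<lambda>f. f)"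
  by (rule bopI[where C = 1]) auto

lemma bop_comp:
  assumes S: "bop S" and T: "bop T"
  shows "bop (\<lambda>f. S (T f))"
proof -
  obtain C where C: "C \<ge> 0" "\<And>f. f \<in> H \<Longrightarrow> nrm (S f) \<le> C * nrm f"
    using S by (rule bop_bound) blast
  obtain D where D: "D \<ge> 0" "\<And>f. f \<in> H \<Longrightarrow> nrm (T f) \<le> D * nrm f"
    using T by (rule bop_bound) blast
  show ?thesis
  proof (rule bopI[where C = "C * D"])
    fix f g h a b assume H: "f \<in> H" "g \<in> H" "h \<in> H"
    \<comment> \<open>\<open>T\<close> is linear only up to \<open>eqv\<close>, so the identity has
      to be carried through \<open>S\<close> by \<open>bop_cong\<close>.\<close>
    have "eqv (T (lc a f b g)) (lc a (T f) b (T g))"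
      using H T by (auto intro!: eqvI simp: bop_lin)
    then have "eqv (S (T (lc a f b g))) (S (lc a (T f) b (T g)))"
      using H T by (intro bop_cong[OF S]) auto
    then show "ip (S (T (lc a f b g))) h = a * ip (S (T f)) h + b * ip (S (T g)) h"
      using H S T by (auto simp: eqvD bop_lin)
  next
    fix f assume f: "f \<in> H"
    have "nrm (S (T f)) \<le> C * nrm (T f)" using C f T by blast
    also have "\<dots> \<le> C * (D * nrm f)" using C D f by (intro mult_left_mono) auto
    finally show "nrm (S (T f)) \<le> C * D * nrm f" by (simp add: mult.assoc)
  qed (use S T in auto)
qed

lemma bop_lc:
  assumes S: "bop S" and T: "bop T"
  shows "bop (\<lambda>f. lc a (S f) b (T f))"
proof -
  obtain C where C: "C \<ge> 0" "\<And>f. f \<in> H \<Longrightarrow> nrm (S f) \<le> C * nrm f"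
    using S by (rule bop_bound) blast
  obtain D where D: "D \<ge> 0" "\<And>f. f \<in> H \<Longrightarrow> nrm (T f) \<le> D * nrm f"
    using T by (rule bop_bound) blast
  show ?thesis
  proof (rule bopI[where C = "cmod a * C + cmod b * D"])
    fix f assume f: "f \<in> H"
    have "nrm (lc a (S f) b (T f)) \<le> cmod a * nrm (S f) + cmod b * nrm (T f)"
      using f S T by (intro nrm_lc_le) auto
    also have "\<dots> \<le> cmod a * (C * nrm f) + cmod b * (D * nrm f)"
      using f C D by (intro add_mono mult_left_mono) auto
    finally show "nrm (lc a (S f) b (T f)) \<le> (cmod a * C + cmod b * D) * nrm f"
      by (simp add: algebra_simps)
  qed (use S T in \<open>auto simp: bop_lin algebra_simps\<close>)
qed

section \<open>The square root iteration and its scalar majorant\<close>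

text \<open>The start \<open>lc 0 f 0 f\<close> represents zero: the carrier type has no zero or
  addition of its own, so everything is expressed through \<open>lc\<close>.\<close>

primrec sqrt_iter :: "('v \<Rightarrow> 'v) \<Rightarrow> nat \<Rightarrow> 'v \<Rightarrow> 'v" where
  "sqrt_iter B 0 = (\<lambda>f. lc 0 f 0 f)"
| "sqrt_iter B (Suc n) = (\<lambda>f. lc (1/2) (B f) (1/2) (sqrt_iter B n (sqrt_iter B n f)))"

end

primrec sqrt_majorant :: "nat \<Rightarrow> real" where
  "sqrt_majorant 0 = 0"
| "sqrt_majorant (Suc n) = (1 + (sqrt_majorant n)\<^sup>2) / 2"

lemma sqrt_majorant_bounds: "0 \<le> sqrt_majorant n" "sqrt_majorant n \<le> 1"
  by (induction n) (auto simp: power_le_one)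

text \<open>The increment equals \<open>(1 - sqrt_majorant n)\<^sup>2 / 2\<close>.\<close>

lemma sqrt_majorant_le_Suc: "sqrt_majorant n \<le> sqrt_majorant (Suc n)"
  using zero_le_power2[of "sqrt_majorant n - 1"] by (simp add: power2_eq_square algebra_simps)

lemma summable_sqrt_majorant: "summable (\<lambda>n. sqrt_majorant (Suc n) - sqrt_majorant n)"
proof -
  have "convergent sqrt_majorant"
    by (rule incseq_convergent[of sqrt_majorant 1])
       (auto intro!: incseq_SucI convergentI simp: sqrt_majorant_le_Suc sqrt_majorant_bounds simp del: sqrt_majorant.simps)
  then show ?thesis by (simp add: summable_iff_convergent sum_lessThan_telescope convergent_diff_const_right_iff del: sqrt_majorant.simps)
qed

context semi_hilbert begin

lemma bop_sqrt_iter: "bop B \<Longrightarrow> bop (sqrt_iter B n)"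
proof (induction n)
  case 0
  show ?case unfolding sqrt_iter.simps by (rule bop_lc[OF bop_id bop_id])
next
  case (Suc n)
  note IH = Suc.IH[OF Suc.prems]
  show ?case
    unfolding sqrt_iter.simps by (rule bop_lc[OF Suc.prems bop_comp[OF IH IH]])
qed

lemma sqrt_iter_sym:
  assumes B: "bop B" "symop B"
  shows "symop (sqrt_iter B n)"
proof (induction n)
  case (Suc n)
  then show ?case
    using B bop_sqrt_iter[OF B(1), of n] by (auto simp: symop_def)
qed (simp add: symop_def)

lemma sqrt_iter_nrm:
  assumes B: "bop B" "\<And>f. f \<in> H \<Longrightarrow> nrm (B f) \<le> nrm f" and "f \<in> H"
  shows "nrm (sqrt_iter B n f) \<le> sqrt_majorant n * nrm f"
  using \<open>f \<in> H\<close>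
proof (induction n arbitrary: f)
  case 0
  then show ?case using nrm_lc_le[of f f 0 0] by simp
next
  case (Suc n)
  note b = bop_in[OF bop_sqrt_iter[OF B(1)]]
  have "nrm (sqrt_iter B n (sqrt_iter B n f)) \<le> sqrt_majorant n * nrm (sqrt_iter B n f)"
    using Suc b by blast
  also have "\<dots> \<le> sqrt_majorant n * (sqrt_majorant n * nrm f)"
    using Suc by (intro mult_left_mono) (auto simp: sqrt_majorant_bounds)
  finally have "nrm (sqrt_iter B n (sqrt_iter B n f)) \<le> (sqrt_majorant n)\<^sup>2 * nrm f"
    by (simp add: power2_eq_square mult.assoc)
  moreover have "nrm (B f) \<le> nrm f" using B(2) Suc.prems .
  ultimately show ?case
    using nrm_lc_le[of "B f" "sqrt_iter B n (sqrt_iter B n f)" "1/2" "1/2"] Suc.prems bop_in[OF B(1)] b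
    by (simp add: algebra_simps)
qed

text \<open>Operator increments are dominated by scalar ones because both obey the same recursion:
  the new increment is half a difference of squares, and each factor in its factorization is bounded
  by its scalar counterpart.\<close>

lemma sqrt_iter_diff:
  assumes B: "bop B" "\<And>f. f \<in> H \<Longrightarrow> nrm (B f) \<le> nrm f" and "f \<in> H"
  shows "nrm (lc 1 (sqrt_iter B (Suc n) f) (-1) (sqrt_iter B n f))
          \<le> (sqrt_majorant (Suc n) - sqrt_majorant n) * nrm f"
  using \<open>f \<in> H\<close>
proof (induction n arbitrary: f)
  case 0
  have "nrm (lc 1 (sqrt_iter B (Suc 0) f) (-1) (sqrt_iter B 0 f)) = nrm (lc (1/2) (B f) 0 f)"
    by (rule eqv_nrm) (use 0 B(1) in \<open>auto intro!: eqvI\<close>)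
  also have "\<dots> \<le> 1/2 * nrm f"
    using nrm_lc_le[of "B f" f "1/2" 0] 0 B(2)[OF 0] bop_in[OF B(1) 0] by simp
  finally show ?case by simp
next
  case (Suc n)
  let ?Z = "sqrt_iter B (Suc n)" and ?Y = "sqrt_iter B n"
  let ?z = "sqrt_majorant (Suc n)" and ?y = "sqrt_majorant n"
  let ?D = "\<lambda>f. lc 1 (?Z f) (-1) (?Y f)"
  have bZ: "bop ?Z" and bY: "bop ?Y" using bop_sqrt_iter[OF B(1)] by blast+
  note IH = Suc.IH and f = Suc.prems
  have d: "0 \<le> ?z - ?y" using sqrt_majorant_le_Suc[of n] by simp
  \<comment> \<open>Z^2 - Y^2 = Z (Z - Y) + (Z - Y) Y needs no commutation of Z and Y.\<close>
  have "nrm (lc 1 (sqrt_iter B (Suc (Suc n)) f) (-1) (?Z f)) = nrm (lc (1/2) (?Z (?D f)) (1/2) (?D (?Y f)))"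
  proof (rule eqv_nrm)
    show "eqv (lc 1 (sqrt_iter B (Suc (Suc n)) f) (-1) (?Z f)) (lc (1/2) (?Z (?D f)) (1/2) (?D (?Y f)))"
    proof (rule eqvI)
      fix h assume h: "h \<in> H"
      have z1: "ip (?Z f) h = (1/2) * ip (B f) h + (1/2) * ip (?Y (?Y f)) h"
        using f h B(1) bY by simp
      have z2: "ip (sqrt_iter B (Suc (Suc n)) f) h = (1/2) * ip (B f) h + (1/2) * ip (?Z (?Z f)) h"
        unfolding sqrt_iter.simps(2)[of B "Suc n"] 
        using f h B(1) bZ bY bop_in[OF bZ] by (simp del: sqrt_iter.simps)
      show "ip (lc 1 (sqrt_iter B (Suc (Suc n)) f) (-1) (?Z f)) h = ip (lc (1/2) (?Z (?D f)) (1/2) (?D (?Y f))) h"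
        using f h bZ bY bop_sqrt_iter[OF B(1), of "Suc (Suc n)"] by (simp add: bop_lin z1 z2 algebra_simps del: sqrt_iter.simps)
    qed
  qed (use f bZ bY bop_sqrt_iter[OF B(1), of "Suc (Suc n)"] in \<open>auto simp del: sqrt_iter.simps\<close>)
  also have "\<dots> \<le> 1/2 * nrm (?Z (?D f)) + 1/2 * nrm (?D (?Y f))"
    using nrm_lc_le[of "?Z (?D f)" "?D (?Y f)" "1/2" "1/2"] f bZ bY by (simp del: sqrt_iter.simps)
  also have "\<dots> \<le> 1/2 * (?z * ((?z - ?y) * nrm f)) + 1/2 * ((?z - ?y) * (?y * nrm f))"
  proof (intro add_mono mult_left_mono)
    have "nrm (?Z (?D f)) \<le> ?z * nrm (?D f)"
      using f bZ bY by (intro sqrt_iter_nrm[OF B]) (auto simp del: sqrt_iter.simps)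
    also have "\<dots> \<le> ?z * ((?z - ?y) * nrm f)"
      by (intro mult_left_mono IH f sqrt_majorant_bounds)
    finally show "nrm (?Z (?D f)) \<le> ?z * ((?z - ?y) * nrm f)" .
    have "nrm (?D (?Y f)) \<le> (?z - ?y) * nrm (?Y f)"
      using f bY by (intro IH) auto
    also have "\<dots> \<le> (?z - ?y) * (?y * nrm f)"
      using d by (intro mult_left_mono sqrt_iter_nrm[OF B] f) 
    finally show "nrm (?D (?Y f)) \<le> (?z - ?y) * (?y * nrm f)" .
  qed auto
  also have "\<dots> = (?z\<^sup>2 - ?y\<^sup>2) / 2 * nrm f"
    by (simp add: power2_eq_square field_simps del: sqrt_majorant.simps)
  also have "\<dots> = (sqrt_majorant (Suc (Suc n)) - ?z) * nrm f"
    unfolding sqrt_majorant.simps(2)[of "Suc n"] using sqrt_majorant.simps(2)[of n]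
    by (metis (no_types, opaque_lifting) add_diff_cancel_left diff_divide_distrib)
  finally show ?case .
qed

text \<open>Each iterate is a polynomial in \<open>B\<close>; the square is passed by moving
  \<open>R\<close> across one factor at a time.\<close>

lemma sqrt_iter_commute:
  assumes B: "bop B" and R: "bop R" and comm: "\<And>f. f \<in> H \<Longrightarrow> eqv (R (B f)) (B (R f))" and "f \<in> H"
  shows "eqv (R (sqrt_iter B n f)) (sqrt_iter B n (R f))"
  using \<open>f \<in> H\<close>
proof (induction n arbitrary: f)
  case 0
  then show ?case using R by (auto intro!: eqvI simp: bop_lin)
next
  case (Suc n)
  note Y = bop_sqrt_iter[OF B, of n]
  have "eqv (R (sqrt_iter B n (sqrt_iter B n f))) (sqrt_iter B n (R (sqrt_iter B n f)))"
    using Suc Y by auto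
  also have "eqv (sqrt_iter B n (R (sqrt_iter B n f))) (sqrt_iter B n (sqrt_iter B n (R f)))"
    using Suc Y R by (intro bop_cong[OF Y]) auto
  finally show ?case
    using R B Y Suc.prems comm[OF Suc.prems] by (auto intro!: eqvI simp: bop_lin eqvD)
qed

text \<open>The iterates converge at each vector, and every property passes to the limit through
  inner products. Commutation is recorded for all \<open>R\<close> at once, since it serves both
  uniqueness of the root and commutation with matrix units.\<close>

proposition sqrt_limit_exists:
  assumes B: "bop B" "\<And>f. f \<in> H \<Longrightarrow> nrm (B f) \<le> nrm f" "symop B"
  obtains Y where "bop Y" "symop Y" "\<And>f. f \<in> H \<Longrightarrow> nrm (Y f) \<le> nrm f"
    "\<And>f h. f \<in> H \<Longrightarrow> h \<in> H \<Longrightarrow> 2 * ip (Y f) h = ip (B f) h + ip (Y (Y f)) h"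
    "\<And>R f. bop R \<Longrightarrow> (\<And>f. f \<in> H \<Longrightarrow> eqv (R (B f)) (B (R f))) \<Longrightarrow> f \<in> H \<Longrightarrow> eqv (R (Y f)) (Y (R f))"
proof -
  let ?Y = "sqrt_iter B"
  note bY = bop_sqrt_iter[OF B(1)]
  note YH = bop_in[OF bY]
  \<comment> \<open>Completeness is phrased for summable increments, which is exactly what the
    majorant supplies.\<close>
  have "\<exists>g\<in>H. (\<lambda>n. nrm (lc 1 (?Y n f) (-1) g)) \<longlonglongrightarrow> 0" if f: "f \<in> H" for f
  proof (rule complete)
    show "summable (\<lambda>n. nrm (lc 1 (?Y (Suc n) f) (-1) (?Y n f)))"
    proof (rule summable_comparison_test')
      show "summable (\<lambda>n. (sqrt_majorant (Suc n) - sqrt_majorant n) * nrm f)"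
        by (rule summable_mult2[OF summable_sqrt_majorant])
      show "norm (nrm (lc 1 (?Y (Suc n) f) (-1) (?Y n f))) \<le> (sqrt_majorant (Suc n) - sqrt_majorant n) * nrm f" for n
        using sqrt_iter_diff[OF B(1,2) f, of n] nrm_ge_0[of "lc 1 (?Y (Suc n) f) (-1) (?Y n f)"] YH f
        by (simp del: sqrt_iter.simps sqrt_majorant.simps)
    qed
  qed (use YH f in auto)
  then obtain Y where YinH: "\<And>f. f \<in> H \<Longrightarrow> Y f \<in> H"
    and lim: "\<And>f. f \<in> H \<Longrightarrow> (\<lambda>n. nrm (lc 1 (?Y n f) (-1) (Y f))) \<longlonglongrightarrow> 0"
    by metis
  have lim_ip: "(\<lambda>n. ip (?Y n f) h) \<longlonglongrightarrow> ip (Y f) h" if "f \<in> H" "h \<in> H" for f h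
    using that YH YinH lim by (intro tendsto_ip) auto
  have Yle: "nrm (?Y n f) \<le> nrm f" if "f \<in> H" for f n
    using sqrt_iter_nrm[OF B(1,2) that, of n] mult_right_mono[OF sqrt_majorant_bounds(2) nrm_ge_0[OF that], of n]
    by simp
  have nY: "nrm (Y f) \<le> nrm f" if f: "f \<in> H" for f
  proof (rule LIMSEQ_le_const)
    show "(\<lambda>n. nrm f + nrm (lc 1 (?Y n f) (-1) (Y f))) \<longlonglongrightarrow> nrm f"
      using tendsto_add[OF tendsto_const lim[OF f], of "nrm f"] by simp
    have "nrm (Y f) \<le> nrm f + nrm (lc 1 (?Y n f) (-1) (Y f))" for n
    proof -
      have "nrm (Y f) = nrm (lc 1 (?Y n f) (-1) (lc 1 (?Y n f) (-1) (Y f)))"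
        by (rule eqv_nrm) (use f YH YinH in \<open>auto intro!: eqvI\<close>)
      also have "\<dots> \<le> nrm (?Y n f) + nrm (lc 1 (?Y n f) (-1) (Y f))"
        using nrm_lc_le[of "?Y n f" "lc 1 (?Y n f) (-1) (Y f)" 1 "-1"] f YH YinH by simp
      finally show ?thesis using Yle[OF f, of n] by simp
    qed
    then show "\<exists>N. \<forall>n\<ge>N. nrm (Y f) \<le> nrm f + nrm (lc 1 (?Y n f) (-1) (Y f))" by blast
  qed
  have bopY: "bop Y"
  proof (rule bopI[where C = 1])
    fix f g h a b assume H: "f \<in> H" "g \<in> H" "h \<in> H"
    have "(\<lambda>n. ip (?Y n (lc a f b g)) h) \<longlonglongrightarrow> a * ip (Y f) h + b * ip (Y g) h"
      using H bY by (simp add: bop_lin) (intro tendsto_intros lim_ip)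
    then show "ip (Y (lc a f b g)) h = a * ip (Y f) h + b * ip (Y g) h"
      using lim_ip[of "lc a f b g" h] H LIMSEQ_unique by blast
  qed (use nY YinH in auto)
  show ?thesis
  proof (rule that[OF bopY _ nY])
    show "symop Y"
      unfolding symop_def
    proof (intro ballI)
      fix f g assume H: "f \<in> H" "g \<in> H"
      have "(\<lambda>n. cnj (ip (?Y n g) f)) \<longlonglongrightarrow> cnj (ip (Y g) f)"
        using H by (intro tendsto_intros lim_ip)
      moreover have "cnj (ip (?Y n g) f) = ip (?Y n f) g" for n
        using sqrt_iter_sym[OF B(1,3), of n] H ip_cnj[of f "?Y n g"] YH by (auto simp: symop_def)
      ultimately have "(\<lambda>n. ip (?Y n f) g) \<longlonglongrightarrow> ip f (Y g)"
        using H ip_cnj[of f "Y g"] YinH by simp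
      then show "ip (Y f) g = ip f (Y g)"
        using lim_ip[OF H] LIMSEQ_unique by blast
    qed
  next
    fix f h assume H: "f \<in> H" "h \<in> H"
    \<comment> \<open>Pointwise limits of products: with \<open>Y_n\<close> for the iterates,
      \<open>Y_n Y_n f - Y Y f = Y_n (Y_n f - Y f) + (Y_n - Y) (Y f)\<close>, and the uniform
      contractivity \<open>Yle\<close> controls the first summand.\<close>
    have "(\<lambda>n. ip (?Y n (?Y n f)) h) \<longlonglongrightarrow> ip (Y (Y f)) h"
    proof (rule tendsto_ip)
      show "(\<lambda>n. nrm (lc 1 (?Y n (?Y n f)) (-1) (Y (Y f)))) \<longlonglongrightarrow> 0"
      proof (rule tendsto_sandwich[OF _ _ tendsto_const])
        show "(\<lambda>n. nrm (lc 1 (?Y n f) (-1) (Y f)) + nrm (lc 1 (?Y n (Y f)) (-1) (Y (Y f)))) \<longlonglongrightarrow> 0"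
          using tendsto_add[OF lim[of f] lim[of "Y f"]] H YinH by simp
        have "nrm (lc 1 (?Y n (?Y n f)) (-1) (Y (Y f))) \<le> nrm (lc 1 (?Y n f) (-1) (Y f)) + nrm (lc 1 (?Y n (Y f)) (-1) (Y (Y f)))" for n
        proof -
          let ?d = "lc 1 (?Y n f) (-1) (Y f)" and ?e = "lc 1 (?Y n (Y f)) (-1) (Y (Y f))"
          have "nrm (lc 1 (?Y n (?Y n f)) (-1) (Y (Y f))) = nrm (lc 1 (?Y n ?d) 1 ?e)"
            by (rule eqv_nrm) (use H YH YinH bY in \<open>auto intro!: eqvI simp: bop_lin\<close>)
          also have "\<dots> \<le> nrm (?Y n ?d) + nrm ?e"
            using nrm_lc_le[of "?Y n ?d" ?e 1 1] H YH YinH by simp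
          also have "\<dots> \<le> nrm ?d + nrm ?e"
            using H YH YinH by (intro add_right_mono Yle) auto
          finally show ?thesis .
        qed
        then show "\<forall>\<^sub>F n in sequentially. nrm (lc 1 (?Y n (?Y n f)) (-1) (Y (Y f))) \<le> nrm (lc 1 (?Y n f) (-1) (Y f)) + nrm (lc 1 (?Y n (Y f)) (-1) (Y (Y f)))"
          by simp
      qed (use H YH YinH in auto)
    qed (use H YH YinH in auto)
    then have "(\<lambda>n. 1/2 * ip (B f) h + 1/2 * ip (?Y n (?Y n f)) h) \<longlonglongrightarrow> 1/2 * ip (B f) h + 1/2 * ip (Y (Y f)) h"
      by (intro tendsto_intros)
    then have "(\<lambda>n. ip (?Y (Suc n) f) h) \<longlonglongrightarrow> 1/2 * ip (B f) h + 1/2 * ip (Y (Y f)) h"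
      using H B(1) YH by simp
    moreover have "(\<lambda>n. ip (?Y (Suc n) f) h) \<longlonglongrightarrow> ip (Y f) h"
      by (rule LIMSEQ_Suc[OF lim_ip[OF H]])
    ultimately have "ip (Y f) h = 1/2 * ip (B f) h + 1/2 * ip (Y (Y f)) h"
      using LIMSEQ_unique by blast
    then show "2 * ip (Y f) h = ip (B f) h + ip (Y (Y f)) h" by simp
  next
    fix R f assume R: "bop R" and comm: "\<And>f. f \<in> H \<Longrightarrow> eqv (R (B f)) (B (R f))" and f: "f \<in> H"
    obtain C where C: "C \<ge> 0" "\<And>f. f \<in> H \<Longrightarrow> nrm (R f) \<le> C * nrm f"
      using R by (rule bop_bound) blast
    show "eqv (R (Y f)) (Y (R f))"
    proof (rule eqvI)
      fix h assume h: "h \<in> H"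
      have "(\<lambda>n. ip (R (?Y n f)) h) \<longlonglongrightarrow> ip (R (Y f)) h"
      proof (rule tendsto_ip)
        show "(\<lambda>n. nrm (lc 1 (R (?Y n f)) (-1) (R (Y f)))) \<longlonglongrightarrow> 0"
          by (rule tendsto_0_le[where K = C, OF lim[OF f]])
             (use C(2)[of "lc 1 (?Y _ f) (-1) (Y f)"] f YH YinH R in
               \<open>auto simp: bop_nrm_diff mult.commute intro!: always_eventually\<close>)
      qed (use R YH YinH f h in auto)
      moreover have "ip (R (?Y n f)) h = ip (?Y n (R f)) h" for n
        by (rule eqvD[OF sqrt_iter_commute[OF B(1) R comm f] h])
      ultimately show "ip (R (Y f)) h = ip (Y (R f)) h"
        using lim_ip[of "R f" h] R f h LIMSEQ_unique by force
    qed
  qed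
qed

section \<open>Positive operators and uniqueness of commuting roots\<close>

definition posop :: "('v \<Rightarrow> 'v) \<Rightarrow> bool" where
  "posop Q \<longleftrightarrow> symop Q \<and> (\<forall>f\<in>H. 0 \<le> Re (ip (Q f) f))"

lemma symopD: "symop T \<Longrightarrow> f \<in> H \<Longrightarrow> g \<in> H \<Longrightarrow> ip (T f) g = ip f (T g)"
  by (simp add: symop_def)

text \<open>If \<open>Q g\<close> were not null, moving from \<open>g\<close> a little in the
  direction \<open>- Q g\<close> would make the quadratic form of \<open>Q\<close> negative.\<close>

lemma posop_null:
  assumes Q: "bop Q" "posop Q" and g: "g \<in> H" and 0: "Re (ip (Q g) g) = 0"
  shows "nrm (Q g) = 0"
proof (rule ccontr)
  assume "nrm (Q g) \<noteq> 0"
  define n where "n = (nrm (Q g))\<^sup>2"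
  define m where "m = Re (ip (Q (Q g)) (Q g))"
  \<comment> \<open>The form at \<open>g - t Q g\<close> is \<open>- 2 * t * n + t * t * m\<close>;
    this step makes it \<open>- t * n - t * t\<close>. The \<open>1\<close> keeps the denominator
    positive when \<open>m = 0\<close>.\<close>
  define t where "t = n / (m + 1)"
  have sym: "symop Q" and pos: "\<And>f. f \<in> H \<Longrightarrow> 0 \<le> Re (ip (Q f) f)"
    using Q by (auto simp: posop_def)
  have n: "n > 0" using \<open>nrm (Q g) \<noteq> 0\<close> by (simp add: n_def)
  have m: "m \<ge> 0" using pos Q g by (auto simp: m_def)
  have "0 \<le> Re (ip (Q (lc 1 g (- of_real t) (Q g))) (lc 1 g (- of_real t) (Q g)))"
    using Q g by (intro pos) auto
  also have "\<dots> = - 2 * t * n + t * t * m"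
    using Q g 0 symopD[OF sym, of "Q g" g] ip_self[of "Q g"]
    by (simp add: bop_lin m_def n_def algebra_simps)
  also have "\<dots> = - t * n - t * t"
  proof -
    have "n = t * (m + 1)" using m by (simp add: t_def)
    then show ?thesis by (simp add: algebra_simps)
  qed
  also have "\<dots> < 0"
  proof -
    have "t > 0" using n m by (simp add: t_def)
    then have "0 < t * n" "0 < t * t" using n by simp_all
    then show ?thesis by linarith
  qed
  finally show False by simp
qed

text \<open>If \<open>Q\<close> and \<open>S\<close> commute and have the same square, then \<open>(Q + S) (Q - S) = 0\<close>;
  pairing with \<open>(Q - S) f\<close> shows that both \<open>Q\<close> and \<open>S\<close> annihilate the range of \<open>Q - S\<close>.\<close>

lemma pos_sqrt_unique:
  assumes Q: "bop Q" "posop Q" and S: "bop S" "posop S"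
    and sq: "\<And>f. f \<in> H \<Longrightarrow> eqv (Q (Q f)) (S (S f))"
    and comm: "\<And>f. f \<in> H \<Longrightarrow> eqv (S (Q f)) (Q (S f))"
    and f: "f \<in> H"
  shows "eqv (Q f) (S f)"
proof -
  let ?g = "lc 1 (Q f) (-1) (S f)"
  have g: "?g \<in> H" using Q S f by auto
  have "ip (Q ?g) ?g + ip (S ?g) ?g = 0"
  proof -
    have "ip (Q ?g) h + ip (S ?g) h = 0" if h: "h \<in> H" for h
      using Q S f h eqvD[OF sq[OF f] h] eqvD[OF comm[OF f] h] by (simp add: bop_lin)
    then show ?thesis using g by blast
  qed
  then have "Re (ip (Q ?g) ?g) + Re (ip (S ?g) ?g) = 0"
    by (metis plus_complex.simps(1) zero_complex.simps(1))
  then have "Re (ip (Q ?g) ?g) = 0" "Re (ip (S ?g) ?g) = 0"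
    using Q S g unfolding posop_def by (smt (verit, best))+
  then have nQ: "nrm (Q ?g) = 0" and nS: "nrm (S ?g) = 0"
    using posop_null[OF Q g] posop_null[OF S g] by blast+
  \<comment> \<open>Symmetry moves \<open>Q\<close> and \<open>S\<close> onto \<open>?g\<close>,
    where both give null vectors, so \<open>?g\<close> is orthogonal to itself.\<close>
  have "ip ?g ?g = ip f (Q ?g) - ip f (S ?g)"
  proof -
    have "ip ?g h = ip f (Q h) - ip f (S h)" if "h \<in> H" for h
      using Q S f that by (simp add: posop_def symopD)
    then show ?thesis using g by blast
  qed
  also have "\<dots> = 0"
    using nrm_0_ip[OF _ f nQ] nrm_0_ip[OF _ f nS] ip_cnj[OF f, of "Q ?g"] ip_cnj[OF f, of "S ?g"] Q S g
    by (simp add: bop_in)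
  finally have "nrm ?g = 0" by (simp add: nrm_eq)
  then show ?thesis using eqv_iff_nrm Q S f by auto
qed

section \<open>Roots of \<open>c\<^sup>2 - T\<^sup>2\<close> and their commutation
  properties\<close>

text \<open>A predicate rather than a chosen root: \<open>op_sqrt\<close> picks its value by
  \<open>SOME\<close>, so the results must hold for any root.\<close>

definition co_sqrt :: "real \<Rightarrow> ('v \<Rightarrow> 'v) \<Rightarrow> ('v \<Rightarrow> 'v) \<Rightarrow> bool" where
  "co_sqrt c T Q \<longleftrightarrow> bop Q \<and> posop Q \<and>
     (\<forall>f\<in>H. eqv (Q (Q f)) (lc (of_real (c\<^sup>2)) f (-1) (T (T f))))"

lemma co_sqrtD:
  assumes "co_sqrt c T Q"
  shows "bop Q" "posop Q" "symop Q"
    and "bop T \<Longrightarrow> f \<in> H \<Longrightarrow> h \<in> H \<Longrightarrow> ip (Q (Q f)) h = of_real (c\<^sup>2) * ip f h - ip (T (T f)) h"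
  using assms by (auto simp: co_sqrt_def posop_def eqv_def)

text \<open>\<open>T\<^sup>2 = c\<^sup>2 - Q\<^sup>2\<close> is a polynomial in \<open>Q\<close>.
  The proof evaluates \<open>Q (Q (Q f))\<close> twice: \<open>Q\<close> applied to the relation at
  \<open>f\<close>, and the relation at \<open>Q f\<close>.\<close>

lemma co_sqrt_commute_self:
  assumes T: "bop T" and Q: "co_sqrt c T Q" and f: "f \<in> H"
  shows "eqv (Q (T (T f))) (T (T (Q f)))"
proof (rule eqvI)
  fix h assume h: "h \<in> H"
  note bQ = co_sqrtD(1)[OF Q]
  have "eqv (Q (Q (Q f))) (Q (lc (of_real (c\<^sup>2)) f (-1) (T (T f))))"
    by (rule bop_cong[OF bQ]) (use Q bQ T f in \<open>auto simp: co_sqrt_def\<close>)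
  from eqvD[OF this h] have "ip (Q (Q (Q f))) h = of_real (c\<^sup>2) * ip (Q f) h - ip (Q (T (T f))) h"
    using bQ T f h by (simp add: bop_lin)
  then show "ip (Q (T (T f))) h = ip (T (T (Q f))) h"
    using co_sqrtD(4)[OF Q T, of "Q f" h] bQ f h by simp
qed

text \<open>The commutation hypothesis on \<open>R\<close> concerns \<open>T\<^sup>2\<close>, not
  \<open>T\<close>, because an arbitrary second root is at first only known to commute with
  \<open>T\<^sup>2\<close>.\<close>

proposition co_sqrt_exists_commuting:
  assumes T: "bop T" "symop T" and c: "c > 0" and le: "\<And>f. f \<in> H \<Longrightarrow> nrm (T f) \<le> c * nrm f"
  obtains Q where "co_sqrt c T Q"
    "\<And>R f. bop R \<Longrightarrow> (\<And>f. f \<in> H \<Longrightarrow> eqv (R (T (T f))) (T (T (R f)))) \<Longrightarrow> f \<in> H \<Longrightarrow> eqv (R (Q f)) (Q (R f))"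
proof -
  \<comment> \<open>The summand \<open>0 f\<close> merely pads the binary \<open>lc\<close> to a
    scalar multiple; dividing by \<open>c\<^sup>2\<close> makes \<open>B\<close> a
    contraction.\<close>
  define B where "B = (\<lambda>f. lc (of_real (1 / c\<^sup>2)) (T (T f)) 0 f)"
  have B: "bop B" unfolding B_def by (rule bop_lc[OF bop_comp[OF T(1) T(1)] bop_id])
  have ipB: "ip (B f) h = of_real (1 / c\<^sup>2) * ip (T (T f)) h" if "f \<in> H" "h \<in> H" for f h
    using that T by (simp add: B_def)
  have "symop B"
    using T by (auto simp: symop_def B_def)
  have "nrm (B f) \<le> nrm f" if f: "f \<in> H" for f
  proof -
    have "nrm (B f) \<le> 1 / c\<^sup>2 * nrm (T (T f))"
      using nrm_lc_le[of "T (T f)" f "of_real (1 / c\<^sup>2)" 0] T f by (simp add: B_def norm_divide norm_power)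
    also have "\<dots> \<le> 1 / c\<^sup>2 * (c * (c * nrm f))"
      using le[of "T f"] le[of f] T f c by (intro mult_left_mono) (auto intro: order_trans[OF _ mult_left_mono])
    finally show ?thesis using c by (simp add: power2_eq_square)
  qed
  from sqrt_limit_exists[OF B this \<open>symop B\<close>] obtain Y where
    Y: "bop Y" "symop Y" "\<And>f. f \<in> H \<Longrightarrow> nrm (Y f) \<le> nrm f"
    and YY: "\<And>f h. f \<in> H \<Longrightarrow> h \<in> H \<Longrightarrow> 2 * ip (Y f) h = ip (B f) h + ip (Y (Y f)) h"
    and comm: "\<And>R f. bop R \<Longrightarrow> (\<And>f. f \<in> H \<Longrightarrow> eqv (R (B f)) (B (R f))) \<Longrightarrow> f \<in> H \<Longrightarrow> eqv (R (Y f)) (Y (R f))"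
    by blast
  define Q where "Q = (\<lambda>f. lc (of_real c) f (- of_real c) (Y f))"
  have bQ: "bop Q" unfolding Q_def by (rule bop_lc[OF bop_id Y(1)])
  have ipQ: "ip (Q f) h = of_real c * (ip f h - ip (Y f) h)" if "f \<in> H" "h \<in> H" for f h
    using that Y by (simp add: Q_def algebra_simps)
  show ?thesis
  proof (rule that)
    have "symop Q"
      using Y by (auto simp: symop_def Q_def)
    moreover have "0 \<le> Re (ip (Q f) f)" if f: "f \<in> H" for f
    proof -
      \<comment> \<open>Positivity of \<open>c (1 - Y)\<close> follows from contractivity of
        \<open>Y\<close>.\<close>
      have "Re (ip (Y f) f) \<le> cmod (ip (Y f) f)" by (rule complex_Re_le_cmod)
      also have "\<dots> \<le> nrm (Y f) * nrm f" using Y f by (intro cauchy_schwarz) auto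
      also have "\<dots> \<le> nrm f * nrm f" using Y f by (intro mult_right_mono) auto
      finally show ?thesis
        using ipQ[OF f f] c ip_self[OF f] by (simp add: power2_eq_square)
    qed
    moreover have "eqv (Q (Q f)) (lc (of_real (c\<^sup>2)) f (-1) (T (T f)))" if f: "f \<in> H" for f
    proof (rule eqvI)
      fix h assume h: "h \<in> H"
      have "ip (Y (Q f)) h = of_real c * (ip (Y f) h - ip (Y (Y f)) h)"
        unfolding Q_def using f h Y by (simp add: bop_lin algebra_simps)
      then have "ip (Q (Q f)) h = of_real c * (of_real c * (ip f h - ip (Y f) h) - of_real c * (ip (Y f) h - ip (Y (Y f)) h))"
        using f h bQ by (simp add: ipQ)
      also have "\<dots> = of_real (c\<^sup>2) * (ip f h - (2 * ip (Y f) h - ip (Y (Y f)) h))"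
        by (simp add: power2_eq_square algebra_simps)
      also have "\<dots> = of_real (c\<^sup>2) * ip f h - ip (T (T f)) h"
        using YY[OF f h] ipB[OF f h] c by (simp add: field_simps)
      finally show "ip (Q (Q f)) h = ip (lc (of_real (c\<^sup>2)) f (-1) (T (T f))) h"
        using T f h by simp
    qed
    ultimately show "co_sqrt c T Q"
      using bQ by (simp add: co_sqrt_def posop_def)
  next
    fix R f assume R: "bop R" and RT: "\<And>f. f \<in> H \<Longrightarrow> eqv (R (T (T f))) (T (T (R f)))" and f: "f \<in> H"
    have "eqv (R (B f)) (B (R f))" if f: "f \<in> H" for f
    proof (rule eqvI)
      fix h assume h: "h \<in> H"
      have "ip (R (B f)) h = of_real (1 / c\<^sup>2) * ip (R (T (T f))) h"
        using R T f h bop_lin[OF R, of "T (T f)" f h "of_real (1 / c\<^sup>2)" 0] by (simp add: B_def)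
      then show "ip (R (B f)) h = ip (B (R f)) h"
        using eqvD[OF RT[OF f] h] ipB[of "R f" h] R f h by simp
    qed
    then have RY: "eqv (R (Y f)) (Y (R f))" using comm R f by blast
    show "eqv (R (Q f)) (Q (R f))"
    proof (rule eqvI)
      fix h assume "h \<in> H"
      then show "ip (R (Q f)) h = ip (Q (R f)) h"
        using R Y(1) f eqvD[OF RY] by (simp add: Q_def bop_lin bop_in)
    qed
  qed
qed

text \<open>The constructed root \<open>S\<close> commutes with the given \<open>Q\<close>, because
  \<open>Q\<close> commutes with \<open>T\<^sup>2\<close>. Uniqueness then identifies
  \<open>Q\<close> with \<open>S\<close>, which transfers the commutation with
  \<open>R\<close>.\<close>

theorem co_sqrt_commute:
  assumes T: "bop T" "symop T" and c: "c > 0" and le: "\<And>f. f \<in> H \<Longrightarrow> nrm (T f) \<le> c * nrm f"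
    and Q: "co_sqrt c T Q" and R: "bop R"
    and RT: "\<And>f. f \<in> H \<Longrightarrow> eqv (R (T f)) (T (R f))" and f: "f \<in> H"
  shows "eqv (R (Q f)) (Q (R f))"
proof -
  obtain S where S: "co_sqrt c T S"
    and comm: "\<And>R f. bop R \<Longrightarrow> (\<And>f. f \<in> H \<Longrightarrow> eqv (R (T (T f))) (T (T (R f)))) \<Longrightarrow> f \<in> H \<Longrightarrow> eqv (R (S f)) (S (R f))"
    using co_sqrt_exists_commuting[OF T c le] by blast
  note bQ = co_sqrtD(1)[OF Q] and bS = co_sqrtD(1)[OF S]
  have QS: "eqv (Q f) (S f)" if "f \<in> H" for f
  proof (rule pos_sqrt_unique[OF co_sqrtD(1,2)[OF Q] co_sqrtD(1,2)[OF S] _ _ that])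
    show "eqv (Q (Q f)) (S (S f))" if "f \<in> H" for f
      using Q S that unfolding co_sqrt_def by (blast intro: eqv_trans eqv_sym)
    show "eqv (S (Q f)) (Q (S f))" if "f \<in> H" for f
      by (rule eqv_sym, rule comm[OF bQ _ that], rule co_sqrt_commute_self[OF T(1) Q])
  qed
  have RTT: "eqv (R (T (T f))) (T (T (R f)))" if f: "f \<in> H" for f
  proof -
    have "eqv (R (T (T f))) (T (R (T f)))" using RT f T by blast
    also have "eqv (T (R (T f))) (T (T (R f)))" using RT f T R by (intro bop_cong[OF T(1)]) auto
    finally show ?thesis .
  qed
  have "eqv (R (Q f)) (R (S f))" using QS f R bQ bS by (intro bop_cong[OF R]) auto
  also have "eqv (R (S f)) (S (R f))" using comm[OF R RTT f] by blast
  also have "eqv (S (R f)) (Q (R f))" using QS R f by (intro eqv_sym[OF QS]) auto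
  finally show ?thesis .
qed

text \<open>With \<open>\<sigma> = \<plusminus> 1\<close>, these two operators are inverse to each other because
  \<open>(T + \<i> Q) (T - \<i> Q) = T\<^sup>2 + Q\<^sup>2 = c\<^sup>2\<close>.\<close>

lemma unitary_factors_inverse:
  assumes T: "bop T" "symop T" and c: "c > 0" and le: "\<And>f. f \<in> H \<Longrightarrow> nrm (T f) \<le> c * nrm f"
    and Q: "co_sqrt c T Q" and \<sigma>: "\<sigma> * \<sigma> = 1"
    and V: "\<And>f. f \<in> H \<Longrightarrow> V f = lc (of_real (1/c)) (T f) (of_real (1/c) * \<sigma> * \<i>) (Q f)"
    and W: "\<And>f. f \<in> H \<Longrightarrow> W f = lc (of_real (1/c)) (T f) (- of_real (1/c) * \<sigma> * \<i>) (Q f)"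
    and f: "f \<in> H"
  shows "eqv (V (W f)) f"
proof (rule eqvI)
  fix h assume h: "h \<in> H"
  note bQ = co_sqrtD(1)[OF Q]
  \<comment> \<open>\<open>co_sqrt_commute\<close> with \<open>R = T\<close>; this cancels the cross
    terms of the product.\<close>
  have TQ: "ip (T (Q f)) h = ip (Q (T f)) h"
    by (rule eqvD[OF co_sqrt_commute[OF T c le Q T(1) _ f] h]) (auto simp: eqv_def)
  have WH: "W f \<in> H" using f T bQ by (simp add: W bop_in)
  have "ip (V (W f)) h = of_real (1/c) * ip (T (W f)) h + of_real (1/c) * \<sigma> * \<i> * ip (Q (W f)) h"
    using V[OF WH] WH T bQ h by (simp add: bop_in)
  also have "\<dots> = of_real (1/c) * of_real (1/c) * (ip (T (T f)) h + (\<sigma> * \<sigma>) * ip (Q (Q f)) h)"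
    using W[OF f] TQ T bQ f h by (simp add: bop_lin bop_in algebra_simps)
  also have "\<dots> = ip f h"
    using \<sigma> co_sqrtD(4)[OF Q T(1) f h] c by (simp add: power2_eq_square)
  finally show "ip (V (W f)) h = ip f h" .
qed

end

section \<open>Completeness of the matrix-valued square-integrable functions\<close>

lemma cmod_diff_sq_le: "(cmod (a - b))\<^sup>2 \<le> 2 * (cmod a)\<^sup>2 + 2 * (cmod b)\<^sup>2"
proof -
  have "(cmod (a - b))\<^sup>2 \<le> (cmod a + cmod b)\<^sup>2"
    by (intro power_mono norm_triangle_ineq4) simp
  also have "\<dots> \<le> 2 * (cmod a)\<^sup>2 + 2 * (cmod b)\<^sup>2"
    using sum_squares_bound[of "cmod a" "cmod b"] by (simp add: power2_sum)
  finally show ?thesis .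
qed

text \<open>Riesz--Fischer for a sequence with summable increments \<open>u n\<close>, \<open>a n = \<parallel>u n\<parallel>\<close>. With weights
  \<open>b n = a n + 2 powr - n\<close> the function \<open>\<Phi> = (\<Sum>n. \<bar>u n\<bar>\<^sup>2 / b n)\<close> is integrable, and
  Cauchy--Schwarz bounds the squared tails of \<open>\<Sum>n. \<bar>u n\<bar>\<close> by the tails of \<open>\<Sum>n. b n\<close> times \<open>\<Phi>\<close>.\<close>

proposition L2_complete_scalar:
  fixes s :: "nat \<Rightarrow> 'a \<Rightarrow> complex"
  assumes meas [measurable]: "\<And>n. s n \<in> borel_measurable M"
    and int: "\<And>n. integrable M (\<lambda>x. (cmod (s n x))\<^sup>2)"
    and sm: "summable (\<lambda>n. sqrt (LINT x|M. (cmod (s (Suc n) x - s n x))\<^sup>2))"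
  obtains g where "g \<in> borel_measurable M" "integrable M (\<lambda>x. (cmod (g x))\<^sup>2)"
    "(\<lambda>n. LINT x|M. (cmod (s n x - g x))\<^sup>2) \<longlonglongrightarrow> 0"
proof -
  define a where "a = (\<lambda>n. sqrt (LINT x|M. (cmod (s (Suc n) x - s n x))\<^sup>2))"
  \<comment> \<open>The geometric term keeps the weights positive where an increment vanishes,
    without losing summability.\<close>
  define b where "b = (\<lambda>n. a n + (1/2)^n)"
  define F where "F = (\<lambda>n x. (cmod (s (Suc n) x - s n x))\<^sup>2 / b n)"
  define \<Phi> where "\<Phi> = (\<lambda>x. \<Sum>n. F n x)"
  \<comment> \<open>\<open>lim\<close> is total, so \<open>g\<close> is defined and measurable
    everywhere; it is the limit wherever the series of \<open>F\<close> converges.\<close>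
  define g where "g = (\<lambda>x. lim (\<lambda>n. s n x))"
  define r where "r = (\<lambda>n. suminf b - sum b {..<n})"
  have a0: "a n \<ge> 0" for n by (simp add: a_def)
  have b0: "b n > 0" for n using a0 by (simp add: b_def add_nonneg_pos)
  have sb: "summable b" unfolding b_def
    using sm by (intro summable_add summable_geometric) (auto simp: a_def)
  have F0: "F n x \<ge> 0" for n x using b0[of n] by (simp add: F_def)
  have intd: "integrable M (\<lambda>x. (cmod (s (Suc n) x - s n x))\<^sup>2)" for n
  proof (rule Bochner_Integration.integrable_bound)
    show "integrable M (\<lambda>x. 2 * (cmod (s (Suc n) x))\<^sup>2 + 2 * (cmod (s n x))\<^sup>2)"
      using int by (intro Bochner_Integration.integrable_add integrable_mult_right) auto
  qed (auto intro!: AE_I2 cmod_diff_sq_le)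
  have intF: "integrable M (F n)" for n
    unfolding F_def using intd by (intro integrable_divide_zero) auto
  have intgF: "(LINT x|M. F n x) \<le> a n" for n
  proof -
    have "(LINT x|M. F n x) = (a n)\<^sup>2 / b n"
      by (simp add: F_def a_def)
    also have "\<dots> \<le> a n"
      using b0[of n] a0[of n] by (simp add: b_def field_simps power2_eq_square)
    finally show ?thesis .
  qed
  have sF: "summable (\<lambda>n. LINT x|M. F n x)"
    by (rule summable_comparison_test'[of a]) (use sm intgF F0 in \<open>auto simp: a_def\<close>)
  have "(\<integral>\<^sup>+x. (\<Sum>n. ennreal (F n x)) \<partial>M) = (\<Sum>n. \<integral>\<^sup>+x. ennreal (F n x) \<partial>M)"
    using intF by (intro nn_integral_suminf) auto
  also have "\<dots> = (\<Sum>n. ennreal (LINT x|M. F n x))"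
    using intF F0 by (simp add: nn_integral_eq_integral)
  also have "\<dots> = ennreal (\<Sum>n. LINT x|M. F n x)"
    using sF F0 by (intro suminf_ennreal2) auto
  finally have "(\<integral>\<^sup>+x. (\<Sum>n. ennreal (F n x)) \<partial>M) \<noteq> \<infinity>" by simp
  then have "AE x in M. (\<Sum>n. ennreal (F n x)) \<noteq> \<infinity>"
    using intF by (intro nn_integral_PInf_AE) auto
  then have AEs: "AE x in M. summable (\<lambda>n. F n x)"
    by eventually_elim (auto intro!: summable_suminf_not_top F0)
  have int\<Phi>: "integrable M \<Phi>"
    unfolding \<Phi>_def
    by (rule integrable_suminf) (use intF AEs sF F0 in auto)
  have bound: "(cmod (s n x - g x))\<^sup>2 \<le> r n * \<Phi> x" if x: "summable (\<lambda>n. F n x)" for n x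
  proof -
    define u where "u = (\<lambda>n. s (Suc n) x - s n x)"
    have uF: "(cmod (u n))\<^sup>2 = b n * F n x" for n
      using b0[of n] by (simp add: F_def u_def)
    have "summable (\<lambda>n. cmod (u n))"
    proof (rule summable_comparison_test')
      \<comment> \<open>Since \<open>(cmod (u n))\<^sup>2 = b n * F n x\<close>, the modulus of
        \<open>u n\<close> is at most \<open>b n + F n x\<close>.\<close>
      show "summable (\<lambda>n. (b n + F n x))"
        using sb x by (intro summable_add)
      show "norm (cmod (u n)) \<le> b n + F n x" for n
      proof (rule power2_le_imp_le)
        have "0 \<le> b n * F n x" "0 \<le> (b n)\<^sup>2" "0 \<le> (F n x)\<^sup>2" using b0[of n] F0[of n x] by auto
        then have "b n * F n x \<le> (b n + F n x)\<^sup>2" unfolding power2_sum by linarith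
        then show "(norm (cmod (u n)))\<^sup>2 \<le> (b n + F n x)\<^sup>2" by (simp add: uF)
      qed (use b0[of n] F0[of n x] in simp)
    qed
    then have "summable u" by (rule summable_norm_cancel)
    then have "convergent (\<lambda>n. \<Sum>i<n. u i)" by (simp add: summable_iff_convergent)
    then have "convergent (\<lambda>n. (\<Sum>i<n. u i) + s 0 x)"
      by (intro convergent_add convergent_const)
    then have "convergent (\<lambda>n. s n x)"
      unfolding u_def sum_lessThan_telescope[of "\<lambda>n. s n x"] by simp
    then have lim: "(\<lambda>n. s n x) \<longlonglongrightarrow> g x"
      by (simp add: g_def convergent_LIMSEQ_iff)
    have le: "(cmod (s n x - s m x))\<^sup>2 \<le> r n * \<Phi> x" if "n \<le> m" for m
    proof -
      have "s m x - s n x = (\<Sum>i=n..<m. u i)"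
        unfolding u_def using sum_Suc_diff'[OF that, of "\<lambda>n. s n x"] by simp
      then have "cmod (s n x - s m x) \<le> (\<Sum>i=n..<m. cmod (u i))"
        by (metis norm_minus_commute norm_sum)
      also have "\<dots> = (\<Sum>i=n..<m. sqrt (b i) * sqrt (F i x))"
        by (intro sum.cong) (simp_all flip: uF real_sqrt_mult)
      finally have "(cmod (s n x - s m x))\<^sup>2 \<le> (\<Sum>i=n..<m. sqrt (b i) * sqrt (F i x))\<^sup>2"
        by (intro power_mono) auto
      also have "\<dots> \<le> (\<Sum>i=n..<m. (sqrt (b i))\<^sup>2) * (\<Sum>i=n..<m. (sqrt (F i x))\<^sup>2)"
        by (rule Cauchy_Schwarz_ineq_sum)
      also have "\<dots> = (\<Sum>i=n..<m. b i) * (\<Sum>i=n..<m. F i x)"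
        using b0 F0 by (simp add: less_imp_le)
      also have "\<dots> \<le> r n * \<Phi> x"
      proof (intro mult_mono)
        have "sum b {..<n} + sum b {n..<m} = sum b {..<m}"
          using that by (subst sum.union_disjoint[symmetric]) (auto intro!: sum.cong)
        moreover have "sum b {..<m} \<le> suminf b"
          using sb b0 by (intro sum_le_suminf) (auto simp: less_imp_le)
        ultimately show "sum b {n..<m} \<le> r n" by (simp add: r_def)
        show "(\<Sum>i=n..<m. F i x) \<le> \<Phi> x"
          unfolding \<Phi>_def using x F0 by (intro sum_le_suminf) auto
        show "0 \<le> r n"
          unfolding r_def using sum_le_suminf[OF sb, of "{..<n}"] b0 by (simp add: less_imp_le)
      qed (use F0 in \<open>auto intro: sum_nonneg\<close>)
      finally show ?thesis .
    qed
    show ?thesis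
    proof (rule LIMSEQ_le_const2)
      show "(\<lambda>m. (cmod (s n x - s m x))\<^sup>2) \<longlonglongrightarrow> (cmod (s n x - g x))\<^sup>2"
        by (intro tendsto_intros lim)
    qed (use le in blast)
  qed
  have gm [measurable]: "g \<in> borel_measurable M"
    unfolding g_def by measurable
  have AEb: "AE x in M. (cmod (s n x - g x))\<^sup>2 \<le> r n * \<Phi> x" for n
    using AEs by eventually_elim (rule bound)
  have intr: "integrable M (\<lambda>x. r n * \<Phi> x)" for n
    using int\<Phi> by simp
  have ints: "integrable M (\<lambda>x. (cmod (s n x - g x))\<^sup>2)" for n
    by (rule Bochner_Integration.integrable_bound[OF intr[of n]])
       (use AEb[of n] in \<open>auto intro: order_trans[OF _ abs_ge_self]\<close>)
  show ?thesis
  proof (rule that[OF gm])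
    show "integrable M (\<lambda>x. (cmod (g x))\<^sup>2)"
    proof (rule Bochner_Integration.integrable_bound)
      \<comment> \<open>Integrability of the limit comes from
        \<open>g = s 0 - (s 0 - g)\<close>.\<close>
      show "integrable M (\<lambda>x. 2 * (cmod (s 0 x))\<^sup>2 + 2 * (cmod (s 0 x - g x))\<^sup>2)"
        using int ints by (intro Bochner_Integration.integrable_add integrable_mult_right) auto
      show "AE x in M. norm ((cmod (g x))\<^sup>2) \<le> norm (2 * (cmod (s 0 x))\<^sup>2 + 2 * (cmod (s 0 x - g x))\<^sup>2)"
      proof (intro AE_I2)
        show "norm ((cmod (g x))\<^sup>2) \<le> norm (2 * (cmod (s 0 x))\<^sup>2 + 2 * (cmod (s 0 x - g x))\<^sup>2)" for x
          using cmod_diff_sq_le[of "s 0 x" "s 0 x - g x"] by simp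
      qed
    qed simp
    have "r \<longlonglongrightarrow> suminf b - suminf b"
      unfolding r_def by (intro tendsto_intros summable_LIMSEQ sb)
    then have "(\<lambda>n. r n * (LINT x|M. \<Phi> x)) \<longlonglongrightarrow> 0"
      using tendsto_mult_left_zero[of r sequentially "LINT x|M. \<Phi> x"] by simp
    then show "(\<lambda>n. LINT x|M. (cmod (s n x - g x))\<^sup>2) \<longlonglongrightarrow> 0"
    proof (rule tendsto_sandwich[OF _ _ tendsto_const, rotated 2])
      have "(LINT x|M. (cmod (s n x - g x))\<^sup>2) \<le> r n * (LINT x|M. \<Phi> x)" for n
        using integral_mono_AE[OF ints intr AEb[of n]] by simp
      then show "\<forall>\<^sub>F n in sequentially. (LINT x|M. (cmod (s n x - g x))\<^sup>2) \<le> r n * (LINT x|M. \<Phi> x)"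
        by simp
    qed simp
  qed
qed

section \<open>Matrix-valued functions, treated entry by entry\<close>

lemma mscale_nth [simp]: "mscale c A $ i $ j = c * A $ i $ j"
  by (simp add: mscale_def)

definition lin2 :: "complex \<Rightarrow> ('g \<Rightarrow> complex^'r^'s) \<Rightarrow> complex \<Rightarrow> ('g \<Rightarrow> complex^'r^'s) \<Rightarrow> 'g \<Rightarrow> complex^'r^'s" where
  "lin2 a f b g = (\<lambda>x. mscale a (f x) + mscale b (g x))"

lemma lin2_nth [simp]: "lin2 a f b g x $ i $ j = a * f x $ i $ j + b * g x $ i $ j"
  by (simp add: lin2_def)

lemma lin2_diff: "lin2 1 f (-1) g = (\<lambda>x. f x - g x)"
  by (simp add: fun_eq_iff vec_eq_iff)

lemma L2m_meas: "f \<in> L2m M \<Longrightarrow> (\<lambda>x. f x $ i $ j) \<in> borel_measurable M"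
  by (simp add: L2m_def)

lemma L2m_int: "f \<in> L2m M \<Longrightarrow> integrable M (\<lambda>x. (cmod (f x $ i $ j))\<^sup>2)"
  by (simp add: L2m_def)

lemma L2m_int_mult:
  assumes f: "f \<in> L2m M" and g: "g \<in> L2m M"
  shows "integrable M (\<lambda>x. f x $ i $ j * cnj (g x $ k $ l))"
proof (rule Bochner_Integration.integrable_bound)
  show "integrable M (\<lambda>x. (cmod (f x $ i $ j))\<^sup>2 + (cmod (g x $ k $ l))\<^sup>2)"
    using f g by (intro Bochner_Integration.integrable_add L2m_int)
  have [measurable]: "(\<lambda>x. f x $ i $ j) \<in> borel_measurable M" "(\<lambda>x. g x $ k $ l) \<in> borel_measurable M"
    using f g by (auto intro: L2m_meas)
  have "(\<lambda>x. cnj (g x $ k $ l)) \<in> borel_measurable M"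
    by (rule borel_measurable_continuous_on[of cnj]) (auto intro: continuous_intros)
  then show "(\<lambda>x. f x $ i $ j * cnj (g x $ k $ l)) \<in> borel_measurable M"
    by measurable
  show "AE x in M. norm (f x $ i $ j * cnj (g x $ k $ l)) \<le> norm ((cmod (f x $ i $ j))\<^sup>2 + (cmod (g x $ k $ l))\<^sup>2)"
  proof (intro AE_I2)
    fix x
    have "0 \<le> cmod (f x $ i $ j) * cmod (g x $ k $ l)" by simp
    with sum_squares_bound[of "cmod (f x $ i $ j)" "cmod (g x $ k $ l)"]
    have "cmod (f x $ i $ j) * cmod (g x $ k $ l) \<le> (cmod (f x $ i $ j))\<^sup>2 + (cmod (g x $ k $ l))\<^sup>2"
      by linarith
    then show "norm (f x $ i $ j * cnj (g x $ k $ l)) \<le> norm ((cmod (f x $ i $ j))\<^sup>2 + (cmod (g x $ k $ l))\<^sup>2)"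
      by (simp add: norm_mult)
  qed
qed

lemma mip_nth:
  assumes "f \<in> L2m M" "g \<in> L2m M"
  shows "mip M f g $ i $ j = (\<Sum>k\<in>UNIV. LINT x|M. f x $ i $ k * cnj (g x $ j $ k))"
  unfolding mip_def using L2m_int_mult[OF assms] by (simp add: Bochner_Integration.integral_sum)

lemma l2inner_sum:
  assumes "f \<in> L2m M" "g \<in> L2m M"
  shows "l2inner M f g = (\<Sum>i\<in>UNIV. \<Sum>k\<in>UNIV. LINT x|M. f x $ i $ k * cnj (g x $ i $ k))"
  by (simp add: l2inner_def mtrace_def mip_nth[OF assms])

lemma l2inner_self:
  assumes "f \<in> L2m M"
  shows "l2inner M f f = of_real (\<Sum>i\<in>UNIV. \<Sum>k\<in>UNIV. LINT x|M. (cmod (f x $ i $ k))\<^sup>2)"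
proof -
  have "(LINT x|M. f x $ i $ k * cnj (f x $ i $ k)) = complex_of_real (LINT x|M. (cmod (f x $ i $ k))\<^sup>2)" for i k
    unfolding complex_norm_square[symmetric] integral_complex_of_real ..
  then show ?thesis unfolding l2inner_sum[OF assms assms] by simp
qed

lemma l2norm_sq:
  assumes "f \<in> L2m M"
  shows "l2norm M f = sqrt (\<Sum>i\<in>UNIV. \<Sum>k\<in>UNIV. LINT x|M. (cmod (f x $ i $ k))\<^sup>2)"
  unfolding l2norm_def l2inner_self[OF assms] by simp

lemma entry_le_l2norm:
  assumes "f \<in> L2m M"
  shows "sqrt (LINT x|M. (cmod (f x $ i $ k))\<^sup>2) \<le> l2norm M f"
  unfolding l2norm_sq[OF assms]
proof (rule real_sqrt_le_mono)
  have "(LINT x|M. (cmod (f x $ i $ k))\<^sup>2) \<le> (\<Sum>k\<in>UNIV. LINT x|M. (cmod (f x $ i $ k))\<^sup>2)"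
    by (rule member_le_sum) auto
  also have "\<dots> \<le> (\<Sum>i\<in>UNIV. \<Sum>k\<in>UNIV. LINT x|M. (cmod (f x $ i $ k))\<^sup>2)"
    by (rule member_le_sum[of i UNIV "\<lambda>i. \<Sum>k\<in>UNIV. LINT x|M. (cmod (f x $ i $ k))\<^sup>2"]) (auto intro: sum_nonneg)
  finally show "(LINT x|M. (cmod (f x $ i $ k))\<^sup>2) \<le> (\<Sum>i\<in>UNIV. \<Sum>k\<in>UNIV. LINT x|M. (cmod (f x $ i $ k))\<^sup>2)" .
qed

lemma L2m_lin2:
  assumes f: "f \<in> L2m M" and g: "g \<in> L2m M"
  shows "lin2 a f b g \<in> L2m M"
  unfolding L2m_def mem_Collect_eq
proof (intro allI conjI)
  fix i j
  have [measurable]: "(\<lambda>x. f x $ i $ j) \<in> borel_measurable M" "(\<lambda>x. g x $ i $ j) \<in> borel_measurable M"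
    using f g by (auto intro: L2m_meas)
  show "(\<lambda>x. lin2 a f b g x $ i $ j) \<in> borel_measurable M" by simp
  show "integrable M (\<lambda>x. (cmod (lin2 a f b g x $ i $ j))\<^sup>2)"
  proof (rule Bochner_Integration.integrable_bound)
    show "integrable M (\<lambda>x. 2 * ((cmod a)\<^sup>2 * (cmod (f x $ i $ j))\<^sup>2) + 2 * ((cmod b)\<^sup>2 * (cmod (g x $ i $ j))\<^sup>2))"
      using f g by (intro Bochner_Integration.integrable_add integrable_mult_right L2m_int)
    show "AE x in M. norm ((cmod (lin2 a f b g x $ i $ j))\<^sup>2)
        \<le> norm (2 * ((cmod a)\<^sup>2 * (cmod (f x $ i $ j))\<^sup>2) + 2 * ((cmod b)\<^sup>2 * (cmod (g x $ i $ j))\<^sup>2))"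
    proof (intro AE_I2)
      fix x
      show "norm ((cmod (lin2 a f b g x $ i $ j))\<^sup>2)
        \<le> norm (2 * ((cmod a)\<^sup>2 * (cmod (f x $ i $ j))\<^sup>2) + 2 * ((cmod b)\<^sup>2 * (cmod (g x $ i $ j))\<^sup>2))"
        using cmod_diff_sq_le[of "a * f x $ i $ j" "- (b * g x $ i $ j)"]
        by (simp add: norm_mult power_mult_distrib)
    qed
  qed simp
qed

text \<open>Each entry has summable increments by \<open>entry_le_l2norm\<close>, so it converges by
  the scalar case; a finite sum over the entries gives convergence of the matrix functions.\<close>

lemma L2m_complete:
  assumes s: "\<And>n. s n \<in> L2m M"
    and sm: "summable (\<lambda>n. l2norm M (\<lambda>x. s (Suc n) x - s n x))"
  shows "\<exists>g\<in>L2m M. (\<lambda>n. l2norm M (\<lambda>x. s n x - g x)) \<longlonglongrightarrow> 0"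
proof -
  have dL: "(\<lambda>x. f x - g x) \<in> L2m M" if "f \<in> L2m M" "g \<in> L2m M" for f g :: "_ \<Rightarrow> complex^_^_"
    using L2m_lin2[OF that, of 1 "-1"] by (simp add: lin2_diff)
  have ex: "\<exists>g. g \<in> borel_measurable M \<and> integrable M (\<lambda>x. (cmod (g x))\<^sup>2) \<and>
      (\<lambda>n. LINT x|M. (cmod (s n x $ i $ j - g x))\<^sup>2) \<longlonglongrightarrow> 0" for i j
  proof -
    have sm': "summable (\<lambda>n. sqrt (LINT x|M. (cmod (s (Suc n) x $ i $ j - s n x $ i $ j))\<^sup>2))"
    proof (rule summable_comparison_test'[OF sm])
      show "norm (sqrt (LINT x|M. (cmod (s (Suc n) x $ i $ j - s n x $ i $ j))\<^sup>2)) \<le> l2norm M (\<lambda>x. s (Suc n) x - s n x)" for n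
        using entry_le_l2norm[OF dL[OF s s], of "Suc n" n i j] by simp
    qed
    show ?thesis
      by (rule L2_complete_scalar[OF L2m_meas[OF s] L2m_int[OF s] sm']) blast
  qed
  define G where "G = (\<lambda>i j. SOME g. g \<in> borel_measurable M \<and> integrable M (\<lambda>x. (cmod (g x))\<^sup>2) \<and>
      (\<lambda>n. LINT x|M. (cmod (s n x $ i $ j - g x))\<^sup>2) \<longlonglongrightarrow> 0)"
  have G: "G i j \<in> borel_measurable M" "integrable M (\<lambda>x. (cmod (G i j x))\<^sup>2)"
    "(\<lambda>n. LINT x|M. (cmod (s n x $ i $ j - G i j x))\<^sup>2) \<longlonglongrightarrow> 0" for i j
    using someI_ex[OF ex[of i j]] by (auto simp: G_def)
  define g where "g = (\<lambda>x. \<chi> i j. G i j x)"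
  have g: "g \<in> L2m M" using G by (simp add: L2m_def g_def)
  have "(\<lambda>n. sqrt (\<Sum>i\<in>UNIV. \<Sum>j\<in>UNIV. LINT x|M. (cmod (s n x $ i $ j - G i j x))\<^sup>2)) \<longlonglongrightarrow> sqrt (\<Sum>i\<in>(UNIV::'c set). \<Sum>j\<in>(UNIV::'b set). 0)"
    by (intro tendsto_intros G)
  moreover have "l2norm M (\<lambda>x. s n x - g x)
      = sqrt (\<Sum>i\<in>UNIV. \<Sum>j\<in>UNIV. LINT x|M. (cmod (s n x $ i $ j - G i j x))\<^sup>2)" for n
    unfolding l2norm_sq[OF dL[OF s g]] by (simp add: g_def)
  ultimately have "(\<lambda>n. l2norm M (\<lambda>x. s n x - g x)) \<longlonglongrightarrow> 0"
    by simp
  then show ?thesis using g by blast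
qed

interpretation l2: semi_hilbert "L2m M :: ('g \<Rightarrow> complex^'b^'c) set" lin2 "l2inner M" "l2norm M" for M :: "'g measure"
proof
  fix f g :: "'g \<Rightarrow> complex^'b^'c" and a b
  assume f: "f \<in> L2m M" and g: "g \<in> L2m M"
  show "lin2 a f b g \<in> L2m M" by (rule L2m_lin2[OF f g])
next
  fix f g h :: "'g \<Rightarrow> complex^'b^'c" and a b
  assume f: "f \<in> L2m M" and g: "g \<in> L2m M" and h: "h \<in> L2m M"
  have "(LINT x|M. lin2 a f b g x $ i $ k * cnj (h x $ i $ k))
      = a * (LINT x|M. f x $ i $ k * cnj (h x $ i $ k)) + b * (LINT x|M. g x $ i $ k * cnj (h x $ i $ k))" for i k
  proof -
    have "(LINT x|M. lin2 a f b g x $ i $ k * cnj (h x $ i $ k))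
      = (LINT x|M. a * (f x $ i $ k * cnj (h x $ i $ k)) + b * (g x $ i $ k * cnj (h x $ i $ k)))"
      by (simp add: algebra_simps)
    also have "\<dots> = a * (LINT x|M. f x $ i $ k * cnj (h x $ i $ k)) + b * (LINT x|M. g x $ i $ k * cnj (h x $ i $ k))"
      using L2m_int_mult[OF f h] L2m_int_mult[OF g h] by simp
    finally show ?thesis .
  qed
  then show "l2inner M (lin2 a f b g) h = a * l2inner M f h + b * l2inner M g h"
    unfolding l2inner_sum[OF f h] l2inner_sum[OF g h] l2inner_sum[OF L2m_lin2[OF f g] h]
    by (simp add: sum.distrib sum_distrib_left)
next
  fix f g :: "'g \<Rightarrow> complex^'b^'c"
  assume f: "f \<in> L2m M" and g: "g \<in> L2m M"
  have "(LINT x|M. f x $ i $ k * cnj (g x $ i $ k)) = cnj (LINT x|M. g x $ i $ k * cnj (f x $ i $ k))" for i k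
    unfolding Bochner_Integration.integral_cnj[symmetric] by (simp add: mult.commute)
  then show "l2inner M f g = cnj (l2inner M g f)"
    unfolding l2inner_sum[OF f g] l2inner_sum[OF g f] by simp
next
  fix f :: "'g \<Rightarrow> complex^'b^'c"
  assume f: "f \<in> L2m M"
  show "0 \<le> Re (l2inner M f f)"
    unfolding l2inner_self[OF f] by (auto intro!: sum_nonneg)
next
  fix f :: "'g \<Rightarrow> complex^'b^'c"
  show "l2norm M f = sqrt (Re (l2inner M f f))" by (rule l2norm_def)
next
  fix s :: "nat \<Rightarrow> 'g \<Rightarrow> complex^'b^'c"
  assume "\<And>n. s n \<in> L2m M" "summable (\<lambda>n. l2norm M (lin2 1 (s (Suc n)) (-1) (s n)))"
  then show "\<exists>g\<in>L2m M. (\<lambda>n. l2norm M (lin2 1 (s n) (-1) g)) \<longlonglongrightarrow> 0"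
    unfolding lin2_diff by (rule L2m_complete)
qed

section \<open>Translation of the operator notions into the abstract setting\<close>

lemma eqL2_iff: "f \<in> L2m M \<Longrightarrow> g \<in> L2m M \<Longrightarrow> eqL2 M f g \<longleftrightarrow> l2.eqv M f g"
  by (simp add: eqL2_def l2.eqv_iff_nrm lin2_diff)

lemma bounded_linear_op_iff:
  fixes T :: "('g \<Rightarrow> complex^'r^'s) \<Rightarrow> ('g \<Rightarrow> complex^'r^'s)"
  shows "bounded_linear_op M T \<longleftrightarrow> l2.bop M T"
proof
  assume T: "bounded_linear_op M T"
  then have TL: "T f \<in> L2m M" if "f \<in> L2m M" for f
    using that by (simp add: bounded_linear_op_def)
  show "l2.bop M T"
    unfolding l2.bop_def
  proof (intro conjI ballI allI)
    fix f g :: "'g \<Rightarrow> complex^'r^'s" and a b assume fg: "f \<in> L2m M" "g \<in> L2m M"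
    then have "eqL2 M (T (lin2 a f b g)) (lin2 a (T f) b (T g))"
      using T unfolding bounded_linear_op_def lin2_def by blast
    then show "l2.eqv M (T (lin2 a f b g)) (lin2 a (T f) b (T g))"
      using fg TL by (simp add: eqL2_iff)
  next
    show "\<exists>C. \<forall>f\<in>L2m M. l2norm M (T f) \<le> C * l2norm M f"
      using T by (simp add: bounded_linear_op_def)
  qed (rule TL)
next
  assume T: "l2.bop M T"
  show "bounded_linear_op M T"
    unfolding bounded_linear_op_def lin2_def[symmetric]
  proof (intro conjI ballI allI impI)
    fix f g :: "'g \<Rightarrow> complex^'r^'s" assume fg: "f \<in> L2m M" "g \<in> L2m M"
    show "eqL2 M f g \<Longrightarrow> eqL2 M (T f) (T g)"
      using fg l2.bop_cong[OF T] T by (simp add: eqL2_iff l2.bop_in)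
    show "eqL2 M (T (lin2 a f b g)) (lin2 a (T f) b (T g))" for a b
      using fg T by (simp add: eqL2_iff l2.bop_in) (simp add: l2.bop_def)
  next
    show "\<exists>C. \<forall>f\<in>L2m M. l2norm M (T f) \<le> C * l2norm M f"
      using T by (simp add: l2.bop_def)
  qed (rule l2.bop_in[OF T])
qed

lemma selfadj_op_iff: "selfadj_op M T \<longleftrightarrow> l2.symop M T"
  by (simp add: selfadj_op_def l2.symop_def)

lemma positive_op_iff:
  assumes "l2.bop M Q"
  shows "positive_op M Q \<longleftrightarrow> l2.posop M Q"
proof -
  have "Im (l2inner M (Q f) f) = 0" if "l2.symop M Q" "f \<in> L2m M" for f
    using l2.symopD[OF that(1) that(2) that(2)] l2.ip_cnj[OF that(2) l2.bop_in[OF assms that(2)]]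
    by (simp add: complex_eq_iff)
  then show ?thesis
    by (auto simp: positive_op_def l2.posop_def selfadj_op_iff)
qed

text \<open>For non-null \<open>f\<close> the normalized vector competes in the supremum defining
  \<open>opnorm\<close>, which is finite by boundedness; null vectors have null images.\<close>

lemma l2norm_le_opnorm:
  assumes T: "l2.bop M T" and f: "f \<in> L2m M"
  shows "l2norm M (T f) \<le> opnorm M T * l2norm M f"
proof -
  obtain C where C: "C \<ge> 0" "\<And>f. f \<in> L2m M \<Longrightarrow> l2norm M (T f) \<le> C * l2norm M f"
    using T by (rule l2.bop_bound) blast
  show ?thesis
  proof (cases "l2norm M f = 0")
    case True
    then show ?thesis using C(2)[OF f] by simp
  next
    case False
    then have pos: "l2norm M f > 0" using l2.nrm_ge_0[OF f] by simp
    define t where "t = 1 / l2norm M f"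
    let ?u = "lin2 (of_real t) f 0 f"
    have t: "t > 0" using pos by (simp add: t_def)
    have nu: "l2norm M (lin2 (of_real t) h 0 h) = t * l2norm M h" if "h \<in> L2m M" for h :: "'a \<Rightarrow> complex^'b^'c"
    proof -
      have "(l2norm M (lin2 (of_real t) h 0 h))\<^sup>2 = (t * l2norm M h)\<^sup>2"
        using l2.nrm_lc_sq[OF that that, of "of_real t" 0] by (simp add: power_mult_distrib)
      then show ?thesis using t that l2.nrm_ge_0 by (simp add: power2_eq_iff_nonneg)
    qed
    have "l2norm M (T ?u) \<le> opnorm M T"
      unfolding opnorm_def
    proof (rule cSup_upper)
      have "l2norm M ?u \<le> 1" using nu[OF f] pos by (simp add: t_def)
      then show "l2norm M (T ?u) \<in> {l2norm M (T f) |f. f \<in> L2m M \<and> l2norm M f \<le> 1}" using f by blast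
      show "bdd_above {l2norm M (T f) |f. f \<in> L2m M \<and> l2norm M f \<le> 1}"
      proof (rule bdd_aboveI[of _ C])
        fix y assume "y \<in> {l2norm M (T f) |f. f \<in> L2m M \<and> l2norm M f \<le> 1}"
        then obtain h where h: "y = l2norm M (T h)" "h \<in> L2m M" "l2norm M h \<le> 1" by blast
        have "y \<le> C * l2norm M h" using C(2)[OF h(2)] h(1) by simp
        also have "\<dots> \<le> C * 1" using C(1) h(3) by (rule mult_left_mono[rotated])
        finally show "y \<le> C" by simp
      qed
    qed
    moreover have "l2norm M (T ?u) = t * l2norm M (T f)"
    proof -
      have "l2norm M (T ?u) = l2norm M (lin2 (of_real t) (T f) 0 (T f))"
        by (rule l2.eqv_nrm) (use f T l2.bop_in[OF T] in \<open>auto intro!: l2.eqvI simp: l2.bop_lin\<close>)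
      then show ?thesis using nu l2.bop_in[OF T f] by simp
    qed
    ultimately have "l2norm M f * (t * l2norm M (T f)) \<le> l2norm M f * opnorm M T"
      using pos by (intro mult_left_mono) auto
    then show ?thesis using pos by (simp add: t_def mult.commute)
  qed
qed

section \<open>Matrix units and adjointability\<close>

text \<open>Left multiplication by the matrix unit with its 1 in row \<open>j\<close> and column
  \<open>i\<close>.\<close>

definition row_move :: "'s \<Rightarrow> 's \<Rightarrow> ('g \<Rightarrow> complex^'r^'s) \<Rightarrow> 'g \<Rightarrow> complex^'r^'s" where
  "row_move i j f = (\<lambda>x. \<chi> a. if a = j then f x $ i else 0)"

lemma row_move_nth [simp]: "row_move i j f x $ a $ b = (if a = j then f x $ i $ b else 0)"
  by (simp add: row_move_def)

lemma row_move_in: "f \<in> L2m M \<Longrightarrow> row_move i j f \<in> L2m M"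
proof -
  assume f: "f \<in> L2m M"
  have "(\<lambda>x. row_move i j f x $ a $ b) \<in> borel_measurable M \<and>
      integrable M (\<lambda>x. (cmod (row_move i j f x $ a $ b))\<^sup>2)" for a b
    using f by (cases "a = j") (simp_all add: L2m_def)
  then show ?thesis by (simp add: L2m_def)
qed

text \<open>Left multiplication by matrix units recovers the entries of the matrix-valued inner product
  from the scalar one; so a self-adjoint operator is adjointable for \<^const>\<open>mip\<close> as soon as it
  commutes with these multiplications.\<close>

lemma l2inner_row_move_left:
  assumes "f \<in> L2m M" "g \<in> L2m M"
  shows "l2inner M (row_move i j f) g = mip M f g $ i $ j"
proof -
  have "(\<Sum>k\<in>UNIV. LINT x|M. row_move i j f x $ a $ k * cnj (g x $ a $ k))
     = (if a = j then (\<Sum>k\<in>UNIV. LINT x|M. f x $ i $ k * cnj (g x $ j $ k)) else 0)" for a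
    by simp
  then show ?thesis
    unfolding l2inner_sum[OF row_move_in[OF assms(1)] assms(2)] mip_nth[OF assms] by simp
qed

text \<open>The adjoint of \<open>row_move i j\<close> is \<open>row_move j i\<close>, hence the
  swapped indices.\<close>

lemma l2inner_row_move_right:
  assumes "f \<in> L2m M" "g \<in> L2m M"
  shows "l2inner M f (row_move j i g) = mip M f g $ i $ j"
proof -
  have "(\<Sum>k\<in>UNIV. LINT x|M. f x $ a $ k * cnj (row_move j i g x $ a $ k))
     = (if a = i then (\<Sum>k\<in>UNIV. LINT x|M. f x $ i $ k * cnj (g x $ j $ k)) else 0)" for a
    by simp
  then show ?thesis
    unfolding l2inner_sum[OF assms(1) row_move_in[OF assms(2)]] mip_nth[OF assms] by simp
qed

text \<open>Makes matrix units admissible as the operator \<open>R\<close> in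
  \<open>co_sqrt_commute\<close>. The bound is 1 because a single row carries at most the full
  norm.\<close>

lemma bop_row_move:
  "l2.bop M (row_move i j :: ('g \<Rightarrow> complex^'r^'s) \<Rightarrow> 'g \<Rightarrow> complex^'r^'s)"
proof (rule l2.bopI[where C = 1])
  fix f g h :: "'g \<Rightarrow> complex^'r^'s" and a b
  assume "f \<in> L2m M" "g \<in> L2m M" "h \<in> L2m M"
  moreover have "row_move i j (lin2 a f b g) = lin2 a (row_move i j f) b (row_move i j g)"
    by (auto simp: fun_eq_iff vec_eq_iff)
  ultimately show "l2inner M (row_move i j (lin2 a f b g)) h
      = a * l2inner M (row_move i j f) h + b * l2inner M (row_move i j g) h"
    by (simp add: row_move_in)
next
  fix f :: "'g \<Rightarrow> complex^'r^'s"
  assume f: "f \<in> L2m M"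
  have "(\<Sum>k\<in>UNIV. LINT x|M. (cmod (row_move i j f x $ a $ k))\<^sup>2)
      = (if a = j then \<Sum>k\<in>UNIV. LINT x|M. (cmod (f x $ i $ k))\<^sup>2 else 0)" for a
    by simp
  moreover have "(\<Sum>k\<in>UNIV. LINT x|M. (cmod (f x $ i $ k))\<^sup>2) \<le> (\<Sum>i\<in>UNIV. \<Sum>k\<in>UNIV. LINT x|M. (cmod (f x $ i $ k))\<^sup>2)"
    by (rule member_le_sum[of i UNIV "\<lambda>i. \<Sum>k\<in>UNIV. LINT x|M. (cmod (f x $ i $ k))\<^sup>2"]) (auto intro: sum_nonneg)
  ultimately show "l2norm M (row_move i j f) \<le> 1 * l2norm M f"
    unfolding l2norm_sq[OF f] l2norm_sq[OF row_move_in[OF f]] by simp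
qed (rule row_move_in)

text \<open>Entry \<open>i\<close>, \<open>j\<close> of either side is a scalar product with
  \<open>row_move i j\<close> applied after or before \<open>T\<close>. The equivalence is used in
  one direction for \<open>T\<close> and in the other for its square root.\<close>

lemma mip_symop_iff:
  assumes T: "l2.bop M T" "l2.symop M T"
  shows "(\<forall>f\<in>L2m M. \<forall>g\<in>L2m M. mip M (T f) g = mip M f (T g))
    \<longleftrightarrow> (\<forall>i j. \<forall>f\<in>L2m M. l2.eqv M (row_move i j (T f)) (T (row_move i j f)))"
proof -
  have "mip M (T f) g $ i $ j = l2inner M (row_move i j (T f)) g"
    "mip M f (T g) $ i $ j = l2inner M (T (row_move i j f)) g" if "f \<in> L2m M" "g \<in> L2m M" for f g i j
    using that T by (simp_all add: l2inner_row_move_left l2.symopD row_move_in l2.bop_in)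
  then show ?thesis
    by (auto simp: vec_eq_iff l2.eqv_def)
qed

text \<open>\<open>mv_adjointable\<close> supplies only some adjoint \<open>S\<close>. Scalar
  self-adjointness identifies it weakly with \<open>T\<close>, and matrix units lift this to every
  entry of \<open>mip\<close>.\<close>

lemma mip_symop:
  assumes T: "l2.bop M T" "l2.symop M T" and adj: "mv_adjointable M T"
    and "f \<in> L2m M" "g \<in> L2m M"
  shows "mip M (T f) g = mip M f (T g)"
proof -
  obtain S where S: "bounded_linear_op M S"
    "\<forall>f \<in> L2m M. \<forall>g \<in> L2m M. l2inner M (T f) g = l2inner M f (S g)"
    "\<forall>f \<in> L2m M. \<forall>g \<in> L2m M. mip M (T f) g = mip M f (S g)"
    using adj unfolding mv_adjointable_def by blast
  have bS: "l2.bop M S" using S(1) by (simp add: bounded_linear_op_iff)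
  have *: "l2inner M f (S g) = l2inner M f (T g)" if "f \<in> L2m M" "g \<in> L2m M" for f g
    using that S(2) l2.symopD[OF T(2)] by simp
  have "mip M f (S g) $ i $ j = mip M f (T g) $ i $ j" for i j
    using assms(4,5) bS T by (simp add: l2inner_row_move_left[symmetric] * row_move_in l2.bop_in)
  then show ?thesis using S(3) assms(4,5) by (simp add: vec_eq_iff)
qed

section \<open>Riesz bases\<close>

text \<open>The matrix unit is placed on \<open>h\<close>, so that linearity of the scalar product
  applies to the untouched combination.\<close>

lemma mip_lin2_left:
  assumes "f \<in> L2m M" "g \<in> L2m M" "h \<in> L2m M"
  shows "mip M (lin2 a f b g) h $ i $ j = a * mip M f h $ i $ j + b * mip M g h $ i $ j"
  using assms by (simp flip: l2inner_row_move_right add: row_move_in)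

lemma mip_lin2_right:
  assumes "f \<in> L2m M" "g \<in> L2m M" "h \<in> L2m M"
  shows "mip M h (lin2 a f b g) $ i $ j = cnj a * mip M h f $ i $ j + cnj b * mip M h g $ i $ j"
  using assms by (simp flip: l2inner_row_move_left add: row_move_in)

lemma l2inner_cong_mip: "mip M f g = mip M f' g' \<Longrightarrow> l2inner M f g = l2inner M f' g'"
  by (simp add: l2inner_def)

text \<open>\<open>W\<close> plays two roles: as inverse of \<open>V\<close> it gives bijectivity,
  and it witnesses adjointability, the scalar identity following by taking traces.\<close>

lemma mv_riesz_image:
  fixes V W :: "('g \<Rightarrow> complex^'r^'s) \<Rightarrow> ('g \<Rightarrow> complex^'r^'s)"
  assumes E: "mv_onb M E" and V: "l2.bop M V" and W: "l2.bop M W"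
    and adj: "\<And>f g. f \<in> L2m M \<Longrightarrow> g \<in> L2m M \<Longrightarrow> mip M (V f) g = mip M f (W g)"
    and VW: "\<And>f. f \<in> L2m M \<Longrightarrow> l2.eqv M (V (W f)) f"
    and WV: "\<And>f. f \<in> L2m M \<Longrightarrow> l2.eqv M (W (V f)) f"
  shows "mv_riesz M (\<lambda>k. V (E k))"
  unfolding mv_riesz_def
proof (intro exI conjI)
  have EL: "E k \<in> L2m M" for k using E by (simp add: mv_onb_def)
  show "bijective_op M V"
    unfolding bijective_op_def
  proof (intro conjI ballI impI)
    fix f g assume fg: "f \<in> L2m M" "g \<in> L2m M" "eqL2 M (V f) (V g)"
    note VL = l2.bop_in[OF V fg(1)] l2.bop_in[OF V fg(2)]
    have "l2.eqv M (W (V f)) (W (V g))"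
      by (rule l2.bop_cong[OF W VL]) (use fg(3) VL in \<open>simp add: eqL2_iff\<close>)
    then have "l2.eqv M f g"
      using WV[OF fg(1)] WV[OF fg(2)] by (blast intro: l2.eqv_trans l2.eqv_sym)
    then show "eqL2 M f g" using fg by (simp add: eqL2_iff)
  next
    fix g :: "'g \<Rightarrow> complex^'r^'s"
    assume "g \<in> L2m M"
    then show "\<exists>f\<in>L2m M. eqL2 M (V f) g"
      using VW[of g] l2.bop_in[OF W, of g] l2.bop_in[OF V, of "W g"]
      by (intro bexI[of _ "W g"]) (simp_all add: eqL2_iff)
  qed
  show "mv_adjointable M V"
    unfolding mv_adjointable_def
    using W adj by (intro exI[of _ W]) (auto simp: bounded_linear_op_iff intro: l2inner_cong_mip)
  show "\<forall>k. V (E k) \<in> L2m M \<and> eqL2 M (V (E k)) (V (E k))"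
    using l2.bop_in[OF V EL] by (simp add: eqL2_iff l2.eqv_def)
qed (use E V in \<open>auto simp: bounded_linear_op_iff\<close>)

text \<open>The predicate under \<open>SOME\<close> is equivalent to \<open>co_sqrt\<close>, so
  existence of one root makes the chosen operator a root.\<close>

lemma op_sqrt_co_sqrt:
  fixes T :: "('g \<Rightarrow> complex^'r^'s) \<Rightarrow> ('g \<Rightarrow> complex^'r^'s)"
  assumes T: "l2.bop M T" "l2.symop M T" and c: "c > 0"
    and le: "\<And>f. f \<in> L2m M \<Longrightarrow> l2norm M (T f) \<le> c * l2norm M f"
  shows "l2.co_sqrt M c T (op_sqrt M (\<lambda>g y. c\<^sup>2 *\<^sub>R g y - T (T g) y))"
proof -
  let ?P = "\<lambda>g y. c\<^sup>2 *\<^sub>R g y - T (T g) y"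
  have P: "?P f = lin2 (of_real (c\<^sup>2)) f (-1) (T (T f))" for f
    by (simp add: fun_eq_iff vec_eq_iff scaleR_conv_of_real[where 'a = complex])
  have iff: "bounded_linear_op M Q \<and> positive_op M Q \<and> (\<forall>f\<in>L2m M. eqL2 M (Q (Q f)) (?P f))
      \<longleftrightarrow> l2.co_sqrt M c T Q" for Q
  proof (cases "l2.bop M Q")
    case True
    then show ?thesis
      unfolding P l2.co_sqrt_def
      using l2.bop_in[OF True] l2.bop_in[OF T(1)]
      by (simp add: bounded_linear_op_iff positive_op_iff eqL2_iff l2.lc_closed)
  qed (simp add: bounded_linear_op_iff l2.co_sqrt_def)
  have "\<exists>Q. l2.co_sqrt M c T Q"
    using l2.co_sqrt_exists_commuting[OF T c le] by metis
  then show ?thesis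
    unfolding op_sqrt_def iff by (rule someI_ex)
qed

theorem theorem3p16:
  fixes M :: "'g::{metric_space,ab_group_add} measure"
    and T :: "('g \<Rightarrow> complex^'r^'s) \<Rightarrow> ('g \<Rightarrow> complex^'r^'s)"
    and E :: "nat \<Rightarrow> ('g \<Rightarrow> complex^'r^'s)"
  assumes "lca_haar M"
    and "bounded_linear_op M T"
    and "selfadj_op M T"
    and "mv_adjointable M T"
    and "\<exists>f \<in> L2m M. \<not> eqL2 M (T f) (\<lambda>x. 0)"
    and "mv_onb M E"
  shows "mv_riesz M (\<lambda>k x. mscale (complex_of_real (1 / opnorm M T))
            (T (E k) x + mscale \<i>
               (op_sqrt M (\<lambda>g y. (opnorm M T)\<^sup>2 *\<^sub>R g y - T (T g) y) (E k) x)))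
       \<and> mv_riesz M (\<lambda>k x. mscale (complex_of_real (1 / opnorm M T))
            (T (E k) x - mscale \<i>
               (op_sqrt M (\<lambda>g y. (opnorm M T)\<^sup>2 *\<^sub>R g y - T (T g) y) (E k) x)))"
proof -
  define c where "c = opnorm M T"
  define Q where "Q = op_sqrt M (\<lambda>g y. c\<^sup>2 *\<^sub>R g y - T (T g) y)"
  have T: "l2.bop M T" "l2.symop M T"
    using assms by (simp_all add: bounded_linear_op_iff selfadj_op_iff)
  have le: "l2norm M (T f) \<le> c * l2norm M f" if "f \<in> L2m M" for f
    unfolding c_def using T(1) that by (rule l2norm_le_opnorm)
  \<comment> \<open>Otherwise the norm bound would make every \<open>T f\<close> null, against
    \<open>T\<close> being nonzero.\<close>
  have c: "c > 0"
  proof (rule ccontr)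
    assume "\<not> c > 0"
    obtain f where f: "f \<in> L2m M" "\<not> eqL2 M (T f) (\<lambda>x. 0)" using assms(5) by blast
    have "c * l2norm M f \<le> 0"
      using \<open>\<not> c > 0\<close> l2.nrm_ge_0[OF f(1)] by (simp add: mult_nonpos_nonneg)
    then have "l2norm M (T f) = 0"
      using le[OF f(1)] l2.nrm_ge_0[OF l2.bop_in[OF T(1) f(1)]] by simp
    then show False using f(2) by (simp add: eqL2_def)
  qed
  have Q: "l2.co_sqrt M c T Q"
    unfolding Q_def using T c le by (rule op_sqrt_co_sqrt)
  note bQ = l2.co_sqrtD(1)[OF Q]
  have mT: "mip M (T f) g = mip M f (T g)" if "f \<in> L2m M" "g \<in> L2m M" for f g
    using T assms(4) that by (rule mip_symop)
  \<comment> \<open>Adjointability passes from \<open>T\<close> to \<open>Q\<close>: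
    \<open>T\<close> commutes with matrix units, hence so does \<open>Q\<close>, hence
    \<open>Q\<close> is adjointable.\<close>
  then have "l2.eqv M (row_move i j (T f)) (T (row_move i j f))" if "f \<in> L2m M" for i j f
    using mip_symop_iff[OF T] that by blast
  then have "l2.eqv M (row_move i j (Q f)) (Q (row_move i j f))" if "f \<in> L2m M" for i j f
    using l2.co_sqrt_commute[OF T c le Q bop_row_move _ that] by blast
  then have mQ: "mip M (Q f) g = mip M f (Q g)" if "f \<in> L2m M" "g \<in> L2m M" for f g
    using mip_symop_iff[OF bQ l2.co_sqrtD(3)[OF Q]] that by blast
  \<comment> \<open>The signs \<open>\<sigma> = 1\<close> and \<open>\<sigma> = -1\<close> give the
    two families; \<open>V (- \<sigma>)\<close> is both inverse and adjoint of
    \<open>V \<sigma>\<close>, the latter because \<open>\<sigma>\<close> is real and \<i> changes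
    sign under conjugation.\<close>
  define V where "V = (\<lambda>\<sigma> f. lin2 (of_real (1/c)) (T f) (of_real (1/c) * \<sigma> * \<i>) (Q f))"
  have bV: "l2.bop M (V \<sigma>)" for \<sigma>
    unfolding V_def by (rule l2.bop_lc[OF T(1) bQ])
  have inv: "l2.eqv M (V \<sigma> (V (- \<sigma>) f)) f" if "\<sigma> * \<sigma> = 1" "f \<in> L2m M" for \<sigma> f
    by (rule l2.unitary_factors_inverse[OF T c le Q that(1) _ _ that(2)]) (simp_all add: V_def)
  have riesz: "mv_riesz M (\<lambda>k. V \<sigma> (E k))" if \<sigma>: "\<sigma> * \<sigma> = 1" "cnj \<sigma> = \<sigma>" for \<sigma>
  proof (rule mv_riesz_image[OF assms(6) bV bV[of "- \<sigma>"]])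
    show "mip M (V \<sigma> f) g = mip M f (V (- \<sigma>) g)" if "f \<in> L2m M" "g \<in> L2m M" for f g
      using that mT mQ l2.bop_in[OF T(1)] l2.bop_in[OF bQ] \<sigma>(2)
      by (simp add: V_def vec_eq_iff mip_lin2_left mip_lin2_right)
  qed (use inv[of \<sigma>] inv[of "- \<sigma>"] \<sigma>(1) in auto)
  have "(\<lambda>x. mscale (of_real (1/c)) (T f x + mscale \<i> (Q f x))) = V 1 f"
    "(\<lambda>x. mscale (of_real (1/c)) (T f x - mscale \<i> (Q f x))) = V (-1) f" for f
    by (simp_all add: V_def fun_eq_iff vec_eq_iff algebra_simps)
  then show ?thesis
    using riesz[of 1] riesz[of "-1"] unfolding c_def[symmetric] Q_def[symmetric] by simp
qed

end
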